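(* Let $\Sigma_{\mathcal P}\sim(A,B,C,D)$ be a poset-causal system with state space $\mathcal X=\bigoplus_{j\in P}\mathcal X_j$ and associated subspaces $\widetilde{\mathcal R}$, $\overline{\mathcal R}$ and $\overline{\mathcal N}$. Define $\widetilde{\mathcal X}=\widetilde{\mathcal R}\ominus(\overline{\mathcal R}\cap\overline{\mathcal N})$ and let $\widetilde A,\widetilde B,\widetilde C$ be the compressions of $A,B,C$ to $\widetilde{\mathcal X}$. Then $\widetilde\Sigma_{\mathcal P}\sim(\widetilde A,\widetilde B,\widetilde C,D)$ is a poset-causal reduction of $\Sigma_{\mathcal P}$ (to the subspace $\widetilde{\mathcal X}$). Furthermore, if $P_{\mathcal X_j}\widetilde{\mathcal X}=P_{\mathcal X_j}\mathcal X_{co}$ for all $j\in P$, and $\widehat{\mathcal X}=\bigoplus_{j\in P}\widehat{\mathcal X}_j$ is a subspace of $\mathcal X$ with $\widehat{\mathcal X}_j\subseteq\mathcal X_j$ for all $j\in P$ such that $\mathcal X_{co}\subseteq\widehat{\mathcal X}$, then $\widetilde{\mathcal X}\subseteq\widehat{\mathcal X}$.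
   Context: Let $\mathcal P=(P,\succeq)$ be a partially ordered set with $P=\{1,\dots,p\}$. For $i\in P$ put ${\downarrow}i=\{j\in P: i\succeq j\}$ and ${\uparrow}i=\{j\in P: j\succeq i\}$. A partition is a tuple $\underline n=(n_1,\dots,n_p)$ of nonnegative integers. $\mathcal I_{\mathcal P}^{\underline n\times\underline m}$ is the space of real block matrices $G=[G_{ij}]_{i,j=1}^p$ with $G_{ij}\in\mathbb R^{n_i\times m_j}$ and $G_{ij}=0$ whenever $j\not\succeq i$. For $R,S\subseteq P$, $G(R,S)$ is the block submatrix of $G$ with block rows indexed by $R$ and block columns indexed by $S$ (a singleton $\{i\}$ is written $i$). A poset-causal system $\Sigma_{\mathcal P}\sim(A,B,C,D)$ is the linear system $\dot x=Ax+Bu$, $y=Cx+Du$ with $A\in\mathcal I_{\mathcal P}^{\underline n\times\underline n}$, $B\in\mathcal I_{\mathcal P}^{\underline n\times\underline m}$, $C\in\mathcal I_{\mathcal P}^{\underline r\times\underline n}$, $D\in\mathcal I_{\mathcal P}^{\underline r\times\underline m}$. Local state spaces are $\mathcal X_i=\mathbb R^{n_i}$, and $\mathcal X=\bigoplus_{i\in P}\mathcal X_i$ (orthogonal direct sum); for $S\subseteq P$, $\mathcal X_S=\bigoplus_{j\in S}\mathcal X_j\subseteq\mathcal X$. $P_{\mathcal V}$ is the orthogonal projection onto $\mathcal V$; for subspaces $\mathcal W\subseteq\mathcal V$, $\mathcal V\ominus\mathcal W$ is the orthogonal complement of $\mathcal W$ in $\mathcal V$. For $A$ of size $N\times N$,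 $\mathcal R(A,B)=\operatorname{Im}[B\ AB\ \cdots\ A^{N-1}B]$ and $\mathcal N(C,A)=\bigcap_{k=0}^{N-1}\ker CA^k$. Write $\mathcal R=\mathcal R(A,B)$, $\mathcal N=\mathcal N(C,A)$ and $\mathcal X_{co}=\mathcal R\ominus(\mathcal R\cap\mathcal N)$. Put $\mathcal R_i=\mathcal R(A({\downarrow}i,{\downarrow}i),B({\downarrow}i,i))\subseteq\mathcal X_{{\downarrow}i}$ and $\mathcal N_i=\mathcal N(C(i,{\uparrow}i),A({\uparrow}i,{\uparrow}i))\subseteq\mathcal X_{{\uparrow}i}$. Then $$\overline{\mathcal R}=\bigoplus_{j\in P}\ \sum_{i\in{\uparrow}j}(\mathcal X_j\cap\mathcal R_i),\qquad\widetilde{\mathcal R}=\bigoplus_{j\in P}\ \sum_{i\in{\uparrow}j}P_{\mathcal X_j}\mathcal R_i,\qquad\overline{\mathcal N}=\bigoplus_{j\in P}\ \bigcap_{i\in{\downarrow}j}(\mathcal N_i\cap\mathcal X_j).$$ The compressions of $A,B,C$ to a subspace $\mathcal V\subseteq\mathcal X$ are $P_{\mathcal V}A|_{\mathcal V}$, $P_{\mathcal V}B$ (as a map into $\mathcal V$) and $C|_{\mathcal V}$. Given a subspace $\widetilde{\mathcal X}=\bigoplus_{j\in P}\widetilde{\mathcal X}_j$ with $\widetilde{\mathcal X}_j\subseteq\mathcal X_j$ for each $j$, and $\widetilde A,\widetilde B,\widetilde C$ the compressions of $A,B,C$ to $\widetilde{\mathcal X}$, the system $\widetilde\Sigma_{\mathcal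 P}\sim(\widetilde A,\widetilde B,\widetilde C,D)$ is called a poset-causal reduction of $\Sigma_{\mathcal P}$ to $\widetilde{\mathcal X}$ if $CA^kB=\widetilde C\widetilde A^k\widetilde B$ for $k=0,1,\dots$. *)

theory Defs
  imports "Jordan_Normal_Form.DL_Submatrix" "Jordan_Normal_Form.Matrix_Kernel"
begin

text \<open>
  The poset is \<open>{1..p}\<close> with a relation \<open>ge\<close>, where \<open>(i, j) \<in> ge\<close> means that \<open>i\<close> dominates \<open>j\<close>.
  A partition is a function \<open>n\<close>, of which only the values on \<open>{1..p}\<close> matter; these may be zero.
  Block matrices and vectors are the usual flat ones, whose (0-based) index range is cut into
  consecutive blocks of lengths \<open>n 1, \<dots>, n p\<close>.
\<close>

definition down :: "nat \<Rightarrow> nat rel \<Rightarrow> nat \<Rightarrow> nat set" where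
  "down p ge i = {j \<in> {1..p}. (i, j) \<in> ge}"

definition up :: "nat \<Rightarrow> nat rel \<Rightarrow> nat \<Rightarrow> nat set" where
  "up p ge i = {j \<in> {1..p}. (j, i) \<in> ge}"

definition total_dim :: "nat \<Rightarrow> (nat \<Rightarrow> nat) \<Rightarrow> nat" where
  "total_dim p n = (\<Sum>i\<in>{1..p}. n i)"

definition blk :: "(nat \<Rightarrow> nat) \<Rightarrow> nat \<Rightarrow> nat set" where
  "blk n i = {(\<Sum>k\<in>{1..<i}. n k)..<(\<Sum>k\<in>{1..i}. n k)}"

definition blks :: "(nat \<Rightarrow> nat) \<Rightarrow> nat set \<Rightarrow> nat set" where
  "blks n S = (\<Union>i\<in>S. blk n i)"

definition block_submat :: "(nat \<Rightarrow> nat) \<Rightarrow> (nat \<Rightarrow> nat) \<Rightarrow> real mat \<Rightarrow> nat set \<Rightarrow> nat set \<Rightarrow> real mat" where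
  "block_submat n m G R S = submatrix G (blks n R) (blks m S)"

definition incidence :: "nat \<Rightarrow> nat rel \<Rightarrow> (nat \<Rightarrow> nat) \<Rightarrow> (nat \<Rightarrow> nat) \<Rightarrow> real mat set" where
  "incidence p ge n m =
     {G \<in> carrier_mat (total_dim p n) (total_dim p m).
        \<forall>i\<in>{1..p}. \<forall>j\<in>{1..p}. (j, i) \<notin> ge \<longrightarrow> block_submat n m G {i} {j} = 0\<^sub>m (n i) (m j)}"

definition poset_causal_system ::
  "nat \<Rightarrow> nat rel \<Rightarrow> (nat \<Rightarrow> nat) \<Rightarrow> (nat \<Rightarrow> nat) \<Rightarrow> (nat \<Rightarrow> nat)
    \<Rightarrow> real mat \<Rightarrow> real mat \<Rightarrow> real mat \<Rightarrow> real mat \<Rightarrow> bool" where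
  "poset_causal_system p ge n m r A B C D \<longleftrightarrow>
     A \<in> incidence p ge n n \<and> B \<in> incidence p ge n m \<and>
     C \<in> incidence p ge r n \<and> D \<in> incidence p ge r m"


section \<open>Subspaces of \<open>\<real>\<^sup>N\<close>\<close>

abbreviation is_subspace :: "nat \<Rightarrow> real vec set \<Rightarrow> bool" where
  "is_subspace N V \<equiv> VectorSpace.subspace class_ring V (module_vec TYPE(real) N)"

definition sum_spaces :: "nat \<Rightarrow> nat set \<Rightarrow> (nat \<Rightarrow> real vec set) \<Rightarrow> real vec set" where
  "sum_spaces N S V = {finsum_vec TYPE(real) N v S | v. \<forall>i\<in>S. v i \<in> V i}"

definition ominus :: "real vec set \<Rightarrow> real vec set \<Rightarrow> real vec set" where
  "ominus V W = {v \<in> V. \<forall>w\<in>W. v \<bullet> w = 0}"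

definition oproj :: "real vec set \<Rightarrow> real vec \<Rightarrow> real vec" where
  "oproj V x = (THE v. v \<in> V \<and> (\<forall>w\<in>V. (x - v) \<bullet> w = 0))"

text \<open>The summand \<open>\<X>\<^sub>j\<close>, as a subspace of the whole space.\<close>

definition local_space :: "nat \<Rightarrow> (nat \<Rightarrow> nat) \<Rightarrow> nat \<Rightarrow> real vec set" where
  "local_space p n j =
     {x \<in> carrier_vec (total_dim p n). \<forall>k<total_dim p n. k \<notin> blk n j \<longrightarrow> x $ k = 0}"

text \<open>
  Submatrices act on short vectors. This is the inclusion of such vectors into \<open>\<real>\<^sup>N\<close>: the entry at
  position \<open>k \<in> I\<close> is the entry of the short vector whose index is the rank of \<open>k\<close> in \<open>I\<close>,
  which is also the index that \<^const>\<open>submatrix\<close> gives to row or column \<open>k\<close>.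
\<close>

definition extend :: "nat \<Rightarrow> nat set \<Rightarrow> real vec \<Rightarrow> real vec" where
  "extend N I v = vec N (\<lambda>k. if k \<in> I then v $ card {a \<in> I. a < k} else 0)"


section \<open>Reachability and observability\<close>

definition ctrb :: "real mat \<Rightarrow> real mat \<Rightarrow> real mat" where
  "ctrb A B =
     mat_of_cols (dim_row A) (concat (map (\<lambda>k. cols (A ^\<^sub>m k * B)) [0..<dim_row A]))"

definition reach :: "real mat \<Rightarrow> real mat \<Rightarrow> real vec set" where
  "reach A B = (\<lambda>u. ctrb A B *\<^sub>v u) ` carrier_vec (dim_col (ctrb A B))"

definition unobs :: "real mat \<Rightarrow> real mat \<Rightarrow> real vec set" where
  "unobs C A = carrier_vec (dim_row A) \<inter> (\<Inter>k<dim_row A. mat_kernel (C * A ^\<^sub>m k))"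

definition X_co :: "real mat \<Rightarrow> real mat \<Rightarrow> real mat \<Rightarrow> real vec set" where
  "X_co A B C = ominus (reach A B) (reach A B \<inter> unobs C A)"

definition R_loc :: "nat \<Rightarrow> nat rel \<Rightarrow> (nat \<Rightarrow> nat) \<Rightarrow> (nat \<Rightarrow> nat) \<Rightarrow> real mat \<Rightarrow> real mat
    \<Rightarrow> nat \<Rightarrow> real vec set" where
  "R_loc p ge n m A B i =
     extend (total_dim p n) (blks n (down p ge i)) `
       reach (block_submat n n A (down p ge i) (down p ge i)) (block_submat n m B (down p ge i) {i})"

definition N_loc :: "nat \<Rightarrow> nat rel \<Rightarrow> (nat \<Rightarrow> nat) \<Rightarrow> (nat \<Rightarrow> nat) \<Rightarrow> real mat \<Rightarrow> real mat
    \<Rightarrow> nat \<Rightarrow> real vec set" where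
  "N_loc p ge n r A C i =
     extend (total_dim p n) (blks n (up p ge i)) `
       unobs (block_submat r n C {i} (up p ge i)) (block_submat n n A (up p ge i) (up p ge i))"

definition R_bar :: "nat \<Rightarrow> nat rel \<Rightarrow> (nat \<Rightarrow> nat) \<Rightarrow> (nat \<Rightarrow> nat) \<Rightarrow> real mat \<Rightarrow> real mat
    \<Rightarrow> real vec set" where
  "R_bar p ge n m A B =
     sum_spaces (total_dim p n) {1..p} (\<lambda>j.
       sum_spaces (total_dim p n) (up p ge j) (\<lambda>i. local_space p n j \<inter> R_loc p ge n m A B i))"

definition R_tilde :: "nat \<Rightarrow> nat rel \<Rightarrow> (nat \<Rightarrow> nat) \<Rightarrow> (nat \<Rightarrow> nat) \<Rightarrow> real mat \<Rightarrow> real mat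
    \<Rightarrow> real vec set" where
  "R_tilde p ge n m A B =
     sum_spaces (total_dim p n) {1..p} (\<lambda>j.
       sum_spaces (total_dim p n) (up p ge j) (\<lambda>i. oproj (local_space p n j) ` R_loc p ge n m A B i))"

definition N_bar :: "nat \<Rightarrow> nat rel \<Rightarrow> (nat \<Rightarrow> nat) \<Rightarrow> (nat \<Rightarrow> nat) \<Rightarrow> real mat \<Rightarrow> real mat
    \<Rightarrow> real vec set" where
  "N_bar p ge n r A C =
     sum_spaces (total_dim p n) {1..p} (\<lambda>j.
       \<Inter>i\<in>down p ge j. N_loc p ge n r A C i \<inter> local_space p n j)"

definition X_tilde :: "nat \<Rightarrow> nat rel \<Rightarrow> (nat \<Rightarrow> nat) \<Rightarrow> (nat \<Rightarrow> nat) \<Rightarrow> (nat \<Rightarrow> nat)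
    \<Rightarrow> real mat \<Rightarrow> real mat \<Rightarrow> real mat \<Rightarrow> real vec set" where
  "X_tilde p ge n m r A B C =
     ominus (R_tilde p ge n m A B) (R_bar p ge n m A B \<inter> N_bar p ge n r A C)"


section \<open>Poset-causal reductions\<close>

text \<open>The compressions to \<open>V\<close>, as linear maps with their domains made explicit.\<close>

definition compr_A :: "real vec set \<Rightarrow> real mat \<Rightarrow> real vec \<Rightarrow> real vec" where
  "compr_A V A = (\<lambda>x\<in>V. oproj V (A *\<^sub>v x))"

definition compr_B :: "real vec set \<Rightarrow> real mat \<Rightarrow> real vec \<Rightarrow> real vec" where
  "compr_B V B = (\<lambda>u\<in>carrier_vec (dim_col B). oproj V (B *\<^sub>v u))"

definition compr_C :: "real vec set \<Rightarrow> real mat \<Rightarrow> real vec \<Rightarrow> real vec" where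
  "compr_C V C = (\<lambda>x\<in>V. C *\<^sub>v x)"

text \<open>
  The analogue of \<^const>\<open>incidence\<close> for a map \<open>T\<close> from the orthogonal sum of the \<open>V j\<close> to that
  of the \<open>W i\<close>: the block from \<open>V j\<close> to \<open>W i\<close> vanishes unless \<open>j\<close> dominates \<open>i\<close>.
\<close>

definition incidence_map ::
  "nat \<Rightarrow> nat rel \<Rightarrow> nat \<Rightarrow> (nat \<Rightarrow> real vec set) \<Rightarrow> (nat \<Rightarrow> real vec set)
    \<Rightarrow> (real vec \<Rightarrow> real vec) \<Rightarrow> bool" where
  "incidence_map p ge N W V T \<longleftrightarrow>
     (\<forall>i\<in>{1..p}. \<forall>j\<in>{1..p}. (j, i) \<notin> ge \<longrightarrow> (\<forall>x\<in>V j. oproj (W i) (T x) = 0\<^sub>v N))"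

definition poset_causal_reduction ::
  "nat \<Rightarrow> nat rel \<Rightarrow> (nat \<Rightarrow> nat) \<Rightarrow> (nat \<Rightarrow> nat) \<Rightarrow> (nat \<Rightarrow> nat)
    \<Rightarrow> real mat \<Rightarrow> real mat \<Rightarrow> real mat \<Rightarrow> real mat \<Rightarrow> real vec set \<Rightarrow> bool" where
  "poset_causal_reduction p ge n m r A B C D X \<longleftrightarrow>
     (\<exists>V. (\<forall>j\<in>{1..p}. is_subspace (total_dim p n) (V j) \<and> V j \<subseteq> local_space p n j) \<and>
          X = sum_spaces (total_dim p n) {1..p} V \<and>
          incidence_map p ge (total_dim p n) V V (compr_A X A) \<and>
          incidence_map p ge (total_dim p n) V (local_space p m) (compr_B X B) \<and>
          incidence_map p ge (total_dim p r) (local_space p r) V (compr_C X C)) \<and>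
     D \<in> incidence p ge r m \<and>
     (\<forall>k. \<forall>u\<in>carrier_vec (total_dim p m).
        (C * A ^\<^sub>m k * B) *\<^sub>v u = compr_C X C ((compr_A X A ^^ k) (compr_B X B u)))"

end

theory Submission
  imports Defs "Jordan_Normal_Form.Char_Poly"
begin

text \<open>
  The local reachable spaces \<open>\<R>\<^sub>i\<close> add up to \<open>\<R>\<close>, because the input space is the sum of its blocks;
  hence \<open>\<R>\<close> lies in \<open>\<R>~\<close>. Conversely the subspace \<open>W\<close> that is removed from \<open>\<R>~\<close> lies in \<open>\<R> \<inter> \<N>\<close>.
  So on \<open>\<R>\<close> the projection to \<open>X = \<R>~ \<ominus> W\<close> changes a state only by a vector of \<open>\<R> \<inter> \<N>\<close>, which is
  \<open>A\<close>-invariant by Cayley--Hamilton, and the outputs agree along every trajectory. Everything is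
  a direct sum over the blocks, so \<open>X\<close> is too, and causality is inherited. A block-decomposed
  subspace is determined by its block projections, which gives minimality.
\<close>

section \<open>Subspaces and orthogonal projections\<close>

text \<open>The two reachability spaces play opposite roles. The projections that build
  \<open>R_tilde\<close> may leave \<open>reach A B\<close>, but they make it large enough to
  contain \<open>reach A B\<close>; the intersections that build \<open>R_bar\<close> keep it inside
  \<open>reach A B\<close>. Since the projection to \<open>X\<close> is understood only on
  \<open>reach A B\<close>, the reduced state must stay reachable at every step, and this holds
  because what is removed comes from \<open>R_bar\<close> and not from \<open>R_tilde\<close>. The
  local spaces are given by submatrices acting on shorter vectors. A down-set is closed under the
  dynamics, so truncating to it is restriction. An up-set receives nothing from outside, so
  truncating to it yields the up-set part of the full trajectory. The definitions of
  \<open>reach\<close> and \<open>unobs\<close> use only powers below the size of the matrix, and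
  this size differs between truncated and full system. Cayley--Hamilton removes the bound, after
  which the two systems can be compared power by power.\<close>

lemma is_subspace_iff:
  "is_subspace N V \<longleftrightarrow> V \<subseteq> carrier_vec N \<and> 0\<^sub>v N \<in> V \<and>
     (\<forall>x\<in>V. \<forall>y\<in>V. x + y \<in> V) \<and> (\<forall>c. \<forall>x\<in>V. c \<cdot>\<^sub>v x \<in> V)"
proof -
  interpret vec_space "TYPE(real)" N .
  show ?thesis
    using vec_vs[of N, where 'a = real] vec_module[of N, where 'a = real]
    by (auto simp: VectorSpace.subspace_def submodule_def module_vec_simps class_ring_simps)
qed

lemma subspaceI:
  assumes "V \<subseteq> carrier_vec N" "0\<^sub>v N \<in> V"
    "\<And>x y. x \<in> V \<Longrightarrow> y \<in> V \<Longrightarrow> x + y \<in> V" "\<And>c x. x \<in> V \<Longrightarrow> c \<cdot>\<^sub>v x \<in> V"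
  shows "is_subspace N V"
  using assms unfolding is_subspace_iff by blast

lemma
  assumes "is_subspace N V"
  shows subspace_carrier: "x \<in> V \<Longrightarrow> x \<in> carrier_vec N"
    and subspace_zero: "0\<^sub>v N \<in> V"
    and subspace_add: "x \<in> V \<Longrightarrow> y \<in> V \<Longrightarrow> x + y \<in> V"
    and subspace_smult: "x \<in> V \<Longrightarrow> c \<cdot>\<^sub>v x \<in> V"
  using assms unfolding is_subspace_iff by blast+

lemma subspace_diff:
  assumes "is_subspace N V" "x \<in> V" "y \<in> V"
  shows "x - y \<in> V"
proof -
  have "x - y = x + (-1) \<cdot>\<^sub>v y"
    using subspace_carrier[OF assms(1)] assms(2,3) by (intro eq_vecI) auto
  then show ?thesis using assms subspace_add subspace_smult by metis
qed

lemma subspace_Int: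
  "is_subspace N V \<Longrightarrow> is_subspace N W \<Longrightarrow> is_subspace N (V \<inter> W)"
  unfolding is_subspace_iff by blast

lemma subspace_INT:
  assumes "S \<noteq> {}" "\<And>i. i \<in> S \<Longrightarrow> is_subspace N (V i)"
  shows "is_subspace N (\<Inter>i\<in>S. V i)"
proof (rule subspaceI)
  obtain i where i: "i \<in> S" using assms(1) by blast
  then show "(\<Inter>i\<in>S. V i) \<subseteq> carrier_vec N" using subspace_carrier[OF assms(2)[OF i]] by blast
  show "0\<^sub>v N \<in> (\<Inter>i\<in>S. V i)" by (rule INT_I) (rule subspace_zero[OF assms(2)])
  show "x + y \<in> (\<Inter>i\<in>S. V i)" if "x \<in> (\<Inter>i\<in>S. V i)" "y \<in> (\<Inter>i\<in>S. V i)" for x y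
    using that by (intro INT_I subspace_add[OF assms(2)]) auto
  show "c \<cdot>\<^sub>v x \<in> (\<Inter>i\<in>S. V i)" if "x \<in> (\<Inter>i\<in>S. V i)" for c x
    using that by (intro INT_I subspace_smult[OF assms(2)]) auto
qed

text \<open>The combination is written entry by entry, the form in which matrix-vector products and
  the Cayley--Hamilton relation produce it.\<close>

lemma subspace_lincomb:
  fixes w :: "nat \<Rightarrow> real vec"
  assumes "is_subspace N V" "\<And>j. j < M \<Longrightarrow> w j \<in> V"
  shows "vec N (\<lambda>i. \<Sum>j<M. c j * w j $ i) \<in> V"
  using assms(2)
proof (induction M)
  case 0
  have "vec N (\<lambda>i. 0) = (0\<^sub>v N :: real vec)" by auto
  then show ?case using subspace_zero[OF assms(1)] by simp
next
  case (Suc M)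
  have "w M \<in> carrier_vec N" using Suc.prems subspace_carrier[OF assms(1)] by blast
  then have "vec N (\<lambda>i. \<Sum>j<Suc M. c j * w j $ i) = vec N (\<lambda>i. \<Sum>j<M. c j * w j $ i) + c M \<cdot>\<^sub>v w M"
    by (intro eq_vecI) auto
  then show ?case
    using Suc subspace_add[OF assms(1)] subspace_smult[OF assms(1)] by simp
qed

lemma subspace_mult_mat_vec:
  fixes G :: "real mat"
  assumes "is_subspace N V" "G \<in> carrier_mat N M" "u \<in> carrier_vec M"
    "\<And>j. j < M \<Longrightarrow> col G j \<in> V"
  shows "G *\<^sub>v u \<in> V"
proof -
  have "G *\<^sub>v u = vec N (\<lambda>i. \<Sum>j<M. u $ j * col G j $ i)"
    using assms(2,3) by (intro eq_vecI) (auto simp: scalar_prod_def atLeast0LessThan intro!: sum.cong)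
  then show ?thesis using subspace_lincomb[OF assms(1,4)] by simp
qed

lemma subspace_image_mat:
  fixes G :: "real mat"
  assumes "G \<in> carrier_mat N M"
  shows "is_subspace N ((\<lambda>u. G *\<^sub>v u) ` carrier_vec M)"
proof (rule subspaceI)
  show "(\<lambda>u. G *\<^sub>v u) ` carrier_vec M \<subseteq> carrier_vec N" using assms by auto
  have "0\<^sub>v N = G *\<^sub>v 0\<^sub>v M" using assms by auto
  then show "0\<^sub>v N \<in> (\<lambda>u. G *\<^sub>v u) ` carrier_vec M" by (rule image_eqI) simp
next
  fix x y assume "x \<in> (\<lambda>u. G *\<^sub>v u) ` carrier_vec M" "y \<in> (\<lambda>u. G *\<^sub>v u) ` carrier_vec M"
  then obtain u v where "x = G *\<^sub>v u" "y = G *\<^sub>v v" "u \<in> carrier_vec M" "v \<in> carrier_vec M" by auto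
  then show "x + y \<in> (\<lambda>u. G *\<^sub>v u) ` carrier_vec M"
    using assms by (auto intro!: image_eqI[of _ _ "u + v"] simp: mult_add_distrib_mat_vec)
next
  fix c x assume "x \<in> (\<lambda>u. G *\<^sub>v u) ` carrier_vec M"
  then obtain u where "x = G *\<^sub>v u" "u \<in> carrier_vec M" by auto
  then show "c \<cdot>\<^sub>v x \<in> (\<lambda>u. G *\<^sub>v u) ` carrier_vec M"
    using assms by (auto intro!: image_eqI[of _ _ "c \<cdot>\<^sub>v u"] simp: mult_mat_vec)
qed

lemma subspace_vimage_mat:
  fixes G :: "real mat"
  assumes "G \<in> carrier_mat N M" "is_subspace N V"
  shows "is_subspace M {x \<in> carrier_vec M. G *\<^sub>v x \<in> V}"
proof -
  have "G *\<^sub>v 0\<^sub>v M = 0\<^sub>v N" using assms(1) by auto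
  then show ?thesis
    using assms subspace_zero[OF assms(2)] subspace_add[OF assms(2)] subspace_smult[OF assms(2)]
    by (intro subspaceI) (auto simp: mult_add_distrib_mat_vec mult_mat_vec)
qed

lemma subspace_zero_space: "is_subspace N {0\<^sub>v N}"
  by (rule subspaceI) auto

lemma subspace_ominus:
  assumes "is_subspace N V" "W \<subseteq> carrier_vec N"
  shows "is_subspace N (ominus V W)"
proof -
  have c: "x \<in> V \<Longrightarrow> x \<in> carrier_vec N" for x using subspace_carrier[OF assms(1)] .
  have "(x + y) \<bullet> w = 0" if "x \<in> V" "y \<in> V" "w \<in> W" "x \<bullet> w = 0" "y \<bullet> w = 0" for x y w
    using add_scalar_prod_distrib[of x N y w] c that assms(2) by auto
  moreover have "(a \<cdot>\<^sub>v x) \<bullet> w = 0" if "x \<in> V" "w \<in> W" "x \<bullet> w = 0" for x w a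
    using smult_scalar_prod_distrib[of x N w a] c that assms(2) by auto
  ultimately show ?thesis
    using assms subspace_zero[OF assms(1)] subspace_add[OF assms(1)] subspace_smult[OF assms(1)] c
    by (intro subspaceI) (auto simp: ominus_def)
qed

text \<open>Induction on the number \<open>k\<close> of coordinates in which \<open>V\<close> may be nonzero: the vectors of \<open>V\<close>
  with vanishing last coordinate have codimension at most one in \<open>V\<close>.\<close>

lemma orthogonal_decomposition_aux:
  assumes "is_subspace N V" "\<And>v i. v \<in> V \<Longrightarrow> k \<le> i \<Longrightarrow> i < N \<Longrightarrow> v $ i = 0" "k \<le> N"
    and "x \<in> carrier_vec N"
  shows "\<exists>v\<in>V. \<forall>w\<in>V. (x - v) \<bullet> w = 0"
  using assms
proof (induction k arbitrary: V x)
  case 0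
  have "w = 0\<^sub>v N" if "w \<in> V" for w
    using 0(2)[OF that] subspace_carrier[OF 0(1) that] by (intro eq_vecI) auto
  then show ?case using subspace_zero[OF 0(1)] 0(4) by (intro bexI[of _ "0\<^sub>v N"]) force+
next
  case (Suc k)
  note car = subspace_carrier[OF Suc.prems(1)]
  have k: "k < N" using Suc.prems(3) by simp
  define V' where "V' = {v \<in> V. v $ k = 0}"
  have V': "is_subspace N V'"
    unfolding V'_def using k subspace_zero[OF Suc.prems(1)] subspace_add[OF Suc.prems(1)]
      subspace_smult[OF Suc.prems(1)] car
    by (intro subspaceI) (auto dest!: car)
  have IH: "\<exists>v\<in>V'. \<forall>w\<in>V'. (y - v) \<bullet> w = 0" if "y \<in> carrier_vec N" for y
  proof (rule Suc.IH[OF V' _ _ that])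
    show "v $ i = 0" if "v \<in> V'" "k \<le> i" "i < N" for v i
      using that Suc.prems(2)[of v i] unfolding V'_def by (cases "i = k") auto
  qed (use k in simp)
  show ?case
  proof (cases "V' = V")
    case True
    then show ?thesis using IH[OF Suc.prems(4)] by simp
  next
    case False
    then obtain w where w: "w \<in> V" "w $ k \<noteq> 0" unfolding V'_def by blast
    obtain b where b: "b \<in> V'" "\<And>z. z \<in> V' \<Longrightarrow> (w - b) \<bullet> z = 0" using IH[OF car[OF w(1)]] by blast
    obtain a where a: "a \<in> V'" "\<And>z. z \<in> V' \<Longrightarrow> (x - a) \<bullet> z = 0" using IH[OF Suc.prems(4)] by blast
    \<comment> \<open>One Gram--Schmidt step: \<open>e\<close> is orthogonal to \<open>V'\<close>
      and keeps the nonzero coordinate \<open>k\<close> of \<open>w\<close>, because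
      \<open>b\<close> vanishes there. So \<open>V\<close> is spanned by \<open>V'\<close> and
      \<open>e\<close>.\<close>
    define e where "e = w - b"
    have bV: "b \<in> V" "b $ k = 0" and aV: "a \<in> V" using a b unfolding V'_def by auto
    have "e $ k = w $ k - b $ k"
      unfolding e_def using k car[OF bV(1)] by (intro index_minus_vec) simp
    then have e: "e \<in> V" "e $ k \<noteq> 0" "e \<in> carrier_vec N"
      using subspace_diff[OF Suc.prems(1) w(1) bV(1)] w(2) bV(2) car unfolding e_def by auto
    have ee: "e \<bullet> e \<noteq> 0"
    proof
      assume "e \<bullet> e = 0"
      then have "\<forall>i\<in>{0..<N}. e $ i * e $ i = 0"
        unfolding scalar_prod_def using e(3) by (subst sum_nonneg_eq_0_iff[symmetric]) auto
      then show False using e(2) k by auto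
    qed
    \<comment> \<open>The coefficient that makes \<open>x - v\<close> orthogonal to
      \<open>e\<close>; orthogonality to \<open>V'\<close> is inherited from
      \<open>a\<close>.\<close>
    define t where "t = (x \<bullet> e) / (e \<bullet> e)"
    define v where "v = a + t \<cdot>\<^sub>v e"
    have vV: "v \<in> V"
      unfolding v_def using aV e subspace_add[OF Suc.prems(1)] subspace_smult[OF Suc.prems(1)] by blast
    have ac: "a \<in> carrier_vec N" using aV car by blast
    have exp: "(x - v) \<bullet> z = (x - a) \<bullet> z - t * (e \<bullet> z)" if "z \<in> carrier_vec N" for z
    proof -
      have "x - v = (x - a) - t \<cdot>\<^sub>v e"
        unfolding v_def using ac e(3) Suc.prems(4) by (intro eq_vecI) auto
      then show ?thesis
        using minus_scalar_prod_distrib[of "x - a" N "t \<cdot>\<^sub>v e" z] ac e(3) Suc.prems(4) that by simp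
    qed
    have o1: "(x - v) \<bullet> z = 0" if "z \<in> V'" for z
      using exp[of z] a(2)[OF that] b(2)[OF that] that car unfolding e_def V'_def by auto
    have "a \<bullet> e = 0"
      using b(2)[OF a(1)] comm_scalar_prod[OF ac e(3)] unfolding e_def by simp
    then have o2: "(x - v) \<bullet> e = 0"
      using exp[OF e(3)] ee minus_scalar_prod_distrib[OF Suc.prems(4) ac e(3)] unfolding t_def by simp
    have "(x - v) \<bullet> z = 0" if z: "z \<in> V" for z
    proof -
      \<comment> \<open>Chosen to cancel coordinate \<open>k\<close>, so that
        \<open>z - c \<cdot>\<^sub>v e\<close> falls into \<open>V'\<close>.\<close>
      define c where "c = z $ k / e $ k"
      have zc: "z \<in> carrier_vec N" using car z .
      have "z - c \<cdot>\<^sub>v e \<in> V"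
        using z e subspace_diff[OF Suc.prems(1)] subspace_smult[OF Suc.prems(1)] by blast
      moreover have "(z - c \<cdot>\<^sub>v e) $ k = 0" unfolding c_def using k e zc by auto
      ultimately have "(x - v) \<bullet> (z - c \<cdot>\<^sub>v e) = 0" using o1 unfolding V'_def by blast
      moreover have xv: "x - v \<in> carrier_vec N" using car[OF vV] Suc.prems(4) by auto
      moreover have "(x - v) \<bullet> (z - c \<cdot>\<^sub>v e) = (x - v) \<bullet> z - c * ((x - v) \<bullet> e)"
        using scalar_prod_minus_distrib[OF xv zc, of "c \<cdot>\<^sub>v e"] e(3) xv by simp
      ultimately show ?thesis using o2 by simp
    qed
    then show ?thesis using vV by blast
  qed
qed

text \<open>Two candidates for the projection differ by a vector of \<open>V\<close> that is
  orthogonal to \<open>V\<close>, hence to itself. This uniqueness makes \<open>THE\<close>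
  computable: every projection below is found by exhibiting a candidate.\<close>

lemma oproj_eqI:
  assumes "is_subspace N V" "x \<in> carrier_vec N" "v \<in> V" "\<And>w. w \<in> V \<Longrightarrow> (x - v) \<bullet> w = 0"
  shows "oproj V x = v"
  unfolding oproj_def
proof (rule the_equality)
  fix u assume u: "u \<in> V \<and> (\<forall>w\<in>V. (x - u) \<bullet> w = 0)"
  note car = subspace_carrier[OF assms(1)]
  have uc: "u \<in> carrier_vec N" and vc: "v \<in> carrier_vec N" using u assms car by auto
  define d where "d = u - v"
  have d: "d \<in> V" "d \<in> carrier_vec N"
    unfolding d_def using u assms subspace_diff[OF assms(1)] car by blast+
  have "d = (x - v) - (x - u)" unfolding d_def using uc vc assms(2) by (intro eq_vecI) auto
  then have "d \<bullet> d = (x - v) \<bullet> d - (x - u) \<bullet> d"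
    using minus_scalar_prod_distrib[of "x - v" N "x - u" d] uc vc d assms(2) by simp
  then have "d \<bullet> d = 0" using u assms(4) d by simp
  then have "\<forall>i\<in>{0..<N}. d $ i * d $ i = 0"
    unfolding scalar_prod_def using d(2) by (subst sum_nonneg_eq_0_iff[symmetric]) auto
  then show "u = v" unfolding d_def using uc vc by (intro eq_vecI) auto
qed (use assms in blast)

lemma
  assumes "is_subspace N V" "x \<in> carrier_vec N"
  shows oproj_mem: "oproj V x \<in> V"
    and oproj_orthogonal: "w \<in> V \<Longrightarrow> (x - oproj V x) \<bullet> w = 0"
proof -
  obtain v where v: "v \<in> V" "\<And>w. w \<in> V \<Longrightarrow> (x - v) \<bullet> w = 0"
    using orthogonal_decomposition_aux[OF assms(1), of N x] assms(2) by auto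
  have "oproj V x = v" by (rule oproj_eqI[OF assms v])
  then show "oproj V x \<in> V" "w \<in> V \<Longrightarrow> (x - oproj V x) \<bullet> w = 0" using v by auto
qed

section \<open>Cayley--Hamilton and Krylov spaces\<close>

text \<open>Compare coefficients in \<open>(x I - A) adj (x I - A) = \<chi>(x) I\<close> and telescope.\<close>

lemma cayley_hamilton_entries:
  fixes A :: "real mat"
  assumes A: "A \<in> carrier_mat N N" and ij: "i < N" "j < N"
  shows "(\<Sum>k\<le>N. coeff (char_poly A) k * (A ^\<^sub>m k) $$ (i, j)) = 0"
proof -
  define P where "P = adj_mat (char_poly_matrix A)"
  \<comment> \<open>The adjugate \<open>P\<close> has polynomial entries; \<open>D k\<close> is its
    real coefficient matrix at degree \<open>k\<close>.\<close>
  define D where "D k = map_mat (\<lambda>q. coeff q k) P" for k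
  let ?X = "coeff (char_poly A)"
  have cp: "char_poly_matrix A \<in> carrier_mat N N" using A by simp
  have P: "P \<in> carrier_mat N N" "char_poly_matrix A * P = char_poly A \<cdot>\<^sub>m 1\<^sub>m N"
    using adj_mat[OF cp] unfolding P_def char_poly_def by auto
  have D: "D k \<in> carrier_mat N N" for k using P unfolding D_def by simp
  have Ak: "A ^\<^sub>m k \<in> carrier_mat N N" for k using A by simp
  have ent: "[:0, 1:] * P $$ (i, j) - (\<Sum>l<N. [:A $$ (i, l):] * P $$ (l, j))
      = (if i = j then char_poly A else 0)" if "i < N" "j < N" for i j
  proof -
    have "(if i = j then char_poly A else 0) = (char_poly_matrix A * P) $$ (i, j)"
      using P(2) that by simp
    also have "\<dots> = (\<Sum>l<N. char_poly_matrix A $$ (i, l) * P $$ (l, j))"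
      using that cp P(1) by (simp add: scalar_prod_def atLeast0LessThan)
    also have "\<dots> = (\<Sum>l<N. (if i = l then [:0, 1:] * P $$ (l, j) else 0) - [:A $$ (i, l):] * P $$ (l, j))"
      using that A by (intro sum.cong) (auto simp: char_poly_matrix_def algebra_simps)
    finally show ?thesis using that by (simp add: sum_subtractf sum.delta)
  qed
  have D0: "A * D 0 = (- ?X 0) \<cdot>\<^sub>m 1\<^sub>m N"
  proof (rule eq_matI)
    fix i j assume "i < dim_row ((- ?X 0) \<cdot>\<^sub>m 1\<^sub>m N)" "j < dim_col ((- ?X 0) \<cdot>\<^sub>m 1\<^sub>m N)"
    then have ij: "i < N" "j < N" by auto
    from arg_cong[OF ent[OF ij], of "\<lambda>q. coeff q 0"]
    show "(A * D 0) $$ (i, j) = ((- ?X 0) \<cdot>\<^sub>m 1\<^sub>m N) $$ (i, j)"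
      using ij A P(1) D[of 0]
      by (auto simp: scalar_prod_def atLeast0LessThan coeff_sum D_def split: if_splits)
  qed (use A D[of 0] in auto)
  have DS: "D k = A * D (Suc k) + ?X (Suc k) \<cdot>\<^sub>m 1\<^sub>m N" for k
  proof (rule eq_matI)
    fix i j assume "i < dim_row (A * D (Suc k) + ?X (Suc k) \<cdot>\<^sub>m 1\<^sub>m N)"
      "j < dim_col (A * D (Suc k) + ?X (Suc k) \<cdot>\<^sub>m 1\<^sub>m N)"
    then have ij: "i < N" "j < N" by auto
    from arg_cong[OF ent[OF ij], of "\<lambda>q. coeff q (Suc k)"]
    show "D k $$ (i, j) = (A * D (Suc k) + ?X (Suc k) \<cdot>\<^sub>m 1\<^sub>m N) $$ (i, j)"
      using ij A P(1) D[of k] D[of "Suc k"]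
      by (auto simp: scalar_prod_def atLeast0LessThan coeff_sum D_def split: if_splits)
  qed (use A D[of k] in auto)
  \<comment> \<open>Multiplying the \<open>k\<close>-th coefficient identity by the
    \<open>k\<close>-th power of \<open>A\<close> makes neighbouring terms cancel; only the last
    adjugate coefficient survives.\<close>
  have tel: "(\<Sum>k\<le>K. ?X k * (A ^\<^sub>m k) $$ (i, j)) = - (A ^\<^sub>m (Suc K) * D K) $$ (i, j)" for K
  proof (induction K)
    case 0
    have "A ^\<^sub>m (Suc 0) * D 0 = A * D 0" using A by simp
    then show ?case using D0 ij A by simp
  next
    case (Suc K)
    have "A ^\<^sub>m (Suc K) * D K = A ^\<^sub>m (Suc K) * (A * D (Suc K)) + A ^\<^sub>m (Suc K) * (?X (Suc K) \<cdot>\<^sub>m 1\<^sub>m N)"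
      using A D[of "Suc K"] by (subst DS, subst mult_add_distrib_mat[OF Ak]) auto
    also have "A ^\<^sub>m (Suc K) * (A * D (Suc K)) = A ^\<^sub>m (Suc (Suc K)) * D (Suc K)"
      using assoc_mult_mat[OF Ak A D, of "Suc K"] by simp
    also have "A ^\<^sub>m (Suc K) * (?X (Suc K) \<cdot>\<^sub>m 1\<^sub>m N) = ?X (Suc K) \<cdot>\<^sub>m A ^\<^sub>m (Suc K)"
      using mult_smult_distrib[OF Ak one_carrier_mat] right_mult_one_mat[OF Ak]
      by (simp del: pow_mat.simps)
    finally have "(A ^\<^sub>m (Suc K) * D K) $$ (i, j)
        = (A ^\<^sub>m (Suc (Suc K)) * D (Suc K)) $$ (i, j) + ?X (Suc K) * (A ^\<^sub>m (Suc K)) $$ (i, j)"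
      using ij A Ak[of "Suc K"] Ak[of "Suc (Suc K)"] D[of "Suc K"] by (simp del: pow_mat.simps)
    then show ?case using Suc by (simp del: pow_mat.simps)
  qed
  obtain K where K: "N \<le> K" "D K = 0\<^sub>m N N"
  proof -
    \<comment> \<open>Beyond the degree of every entry of \<open>P\<close>, so that the surviving
      term vanishes, and at least \<open>N\<close>, so that the partial sum contains the whole
      characteristic polynomial.\<close>
    define K where "K = Max (insert N ((\<lambda>(i, j). Suc (degree (P $$ (i, j)))) ` ({..<N} \<times> {..<N})))"
    have "degree (P $$ (i, j)) < K" if "i < N" "j < N" for i j
    proof -
      have "Suc (degree (P $$ (i, j))) \<le> K"
        unfolding K_def by (rule Max_ge) (use that in \<open>auto intro!: image_eqI[of _ _ "(i, j)"]\<close>)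
      then show ?thesis by simp
    qed
    then have "D K = 0\<^sub>m N N" using P(1) unfolding D_def by (intro eq_matI) (auto simp: coeff_eq_0)
    moreover have "N \<le> K" unfolding K_def by (rule Max_ge) auto
    ultimately show ?thesis using that by blast
  qed
  have "(\<Sum>k\<le>N. ?X k * (A ^\<^sub>m k) $$ (i, j)) = (\<Sum>k\<le>K. ?X k * (A ^\<^sub>m k) $$ (i, j))"
  proof (rule sum.mono_neutral_left)
    have "degree (char_poly A) = N" using degree_monic_char_poly[OF A] by simp
    then show "\<forall>k\<in>{..K} - {..N}. ?X k * (A ^\<^sub>m k) $$ (i, j) = 0" by (auto simp: coeff_eq_0)
  qed (use K in auto)
  also have "\<dots> = 0"
    unfolding tel K(2) right_mult_zero_mat[OF Ak] using ij by simp
  finally show ?thesis .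
qed

lemma pow_mat_mult_vec_carrier:
  assumes "A \<in> carrier_mat N N" "x \<in> carrier_vec N"
  shows "A ^\<^sub>m k *\<^sub>v x \<in> carrier_vec N"
  using mult_mat_vec_carrier[OF pow_carrier_mat[OF assms(1)] assms(2)] .

lemma pow_mat_add_mult_vec:
  fixes A :: "real mat"
  assumes "A \<in> carrier_mat N N" "x \<in> carrier_vec N"
  shows "(A ^\<^sub>m (k + l)) *\<^sub>v x = A ^\<^sub>m k *\<^sub>v (A ^\<^sub>m l *\<^sub>v x)"
  using assms(2)
proof (induction l arbitrary: x)
  case 0
  have "1\<^sub>m N *\<^sub>v x = x" using 0 by simp
  then show ?case using assms(1) by simp
next
  case (Suc l)
  have c: "A ^\<^sub>m j \<in> carrier_mat N N" for j using assms(1) by simp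
  show ?case
    using Suc.IH[of "A *\<^sub>v x"] Suc.prems assms(1)
      assoc_mult_mat_vec[OF c assms(1) Suc.prems] by auto
qed

text \<open>The recursion of \<open>pow_mat\<close> puts the new factor on the right, whereas
  following a trajectory means applying \<open>A\<close> last.\<close>

lemma pow_mat_Suc_mult_vec:
  fixes A :: "real mat"
  assumes "A \<in> carrier_mat N N" "x \<in> carrier_vec N"
  shows "(A ^\<^sub>m Suc k) *\<^sub>v x = A *\<^sub>v (A ^\<^sub>m k *\<^sub>v x)"
  using pow_mat_add_mult_vec[OF assms, of 1 k] assms(1) by simp

lemma index_mult_mat_vec_sum:
  assumes "G \<in> carrier_mat N M" "x \<in> carrier_vec M" "i < N"
  shows "(G *\<^sub>v x) $ i = (\<Sum>b<M. G $$ (i, b) * x $ b)"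
  using assms by (auto simp: scalar_prod_def atLeast0LessThan)

lemma sum_mult_lincomb_swap:
  fixes c :: "'a \<Rightarrow> real"
  shows "(\<Sum>b\<in>B. y b * (\<Sum>j\<in>J. c j * g j b)) = (\<Sum>j\<in>J. c j * (\<Sum>b\<in>B. y b * g j b))"
  by (simp add: sum_distrib_left mult.left_commute, rule sum.swap)

text \<open>For \<open>k\<close> at least \<open>N\<close>, Cayley--Hamilton writes the
  \<open>k\<close>-th vector as a combination of the \<open>N\<close> preceding ones, so strong
  induction applies. The matrix \<open>F\<close> serves both uses: the identity for reachability,
  and \<open>C\<close> with the zero space as \<open>V\<close> for observability.\<close>

lemma pow_mult_vec_subspace:
  fixes A :: "real mat"
  assumes A: "A \<in> carrier_mat N N" and x: "x \<in> carrier_vec N" and V: "is_subspace M V"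
    and F: "F \<in> carrier_mat M N"
    and small: "\<And>k. k < N \<Longrightarrow> F *\<^sub>v (A ^\<^sub>m k *\<^sub>v x) \<in> V"
  shows "F *\<^sub>v (A ^\<^sub>m k *\<^sub>v x) \<in> V"
proof (induction k rule: less_induct)
  case (less k)
  show ?case
  proof (cases "k < N")
    case False
    define l where "l = k - N"
    have k: "k = l + N" unfolding l_def using False by simp
    \<comment> \<open>The characteristic polynomial is monic; solving for the top power leaves its
      negated lower coefficients.\<close>
    let ?c = "\<lambda>j. - coeff (char_poly A) j"
    have Aj: "A ^\<^sub>m j \<in> carrier_mat N N" for j using A by simp
    have top: "coeff (char_poly A) N = 1" using degree_monic_char_poly[OF A] by auto
    have ent: "(A ^\<^sub>m N) $$ (i, j) = (\<Sum>k<N. ?c k * (A ^\<^sub>m k) $$ (i, j))" if "i < N" "j < N" for i j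
      using cayley_hamilton_entries[OF A that] top
      by (simp add: lessThan_Suc_atMost[symmetric] sum_negf)
    have AN: "(A ^\<^sub>m N *\<^sub>v y) $ i = (\<Sum>j<N. ?c j * (A ^\<^sub>m j *\<^sub>v y) $ i)"
      if "y \<in> carrier_vec N" "i < N" for y i
    proof -
      have "(A ^\<^sub>m N *\<^sub>v y) $ i = (\<Sum>b<N. (A ^\<^sub>m N) $$ (i, b) * y $ b)"
        by (rule index_mult_mat_vec_sum[OF Aj that])
      also have "\<dots> = (\<Sum>b<N. y $ b * (\<Sum>j<N. ?c j * (A ^\<^sub>m j) $$ (i, b)))"
        using that ent by (intro sum.cong) (auto simp del: mult_minus_left)
      also have "\<dots> = (\<Sum>j<N. ?c j * (\<Sum>b<N. y $ b * (A ^\<^sub>m j) $$ (i, b)))"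
        by (rule sum_mult_lincomb_swap)
      also have "\<dots> = (\<Sum>j<N. ?c j * (A ^\<^sub>m j *\<^sub>v y) $ i)"
        by (intro sum.cong refl) (simp add: index_mult_mat_vec_sum[OF Aj that] mult.commute)
      finally show ?thesis .
    qed
    have ax: "A ^\<^sub>m j *\<^sub>v x \<in> carrier_vec N" for j by (rule pow_mat_mult_vec_carrier[OF A x])
    have "A ^\<^sub>m k *\<^sub>v x = A ^\<^sub>m N *\<^sub>v (A ^\<^sub>m l *\<^sub>v x)"
      using pow_mat_add_mult_vec[OF A x, of N l] k by (simp add: add.commute)
    then have Ak: "(A ^\<^sub>m k *\<^sub>v x) $ i = (\<Sum>j<N. ?c j * (A ^\<^sub>m (j + l) *\<^sub>v x) $ i)" if "i < N" for i
      using AN[OF ax that] pow_mat_add_mult_vec[OF A x] by simp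
    have "F *\<^sub>v (A ^\<^sub>m k *\<^sub>v x) = vec M (\<lambda>i. \<Sum>j<N. ?c j * (F *\<^sub>v (A ^\<^sub>m (j + l) *\<^sub>v x)) $ i)"
    proof (rule eq_vecI)
      fix i assume "i < dim_vec (vec M (\<lambda>i. \<Sum>j<N. ?c j * (F *\<^sub>v (A ^\<^sub>m (j + l) *\<^sub>v x)) $ i))"
      then have i: "i < M" by simp
      have "(F *\<^sub>v (A ^\<^sub>m k *\<^sub>v x)) $ i = (\<Sum>b<N. F $$ (i, b) * (\<Sum>j<N. ?c j * (A ^\<^sub>m (j + l) *\<^sub>v x) $ b))"
        unfolding index_mult_mat_vec_sum[OF F ax i] by (intro sum.cong refl) (simp add: Ak)
      also have "\<dots> = (\<Sum>j<N. ?c j * (\<Sum>b<N. F $$ (i, b) * (A ^\<^sub>m (j + l) *\<^sub>v x) $ b))"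
        by (rule sum_mult_lincomb_swap)
      also have "\<dots> = (\<Sum>j<N. ?c j * (F *\<^sub>v (A ^\<^sub>m (j + l) *\<^sub>v x)) $ i)"
        unfolding index_mult_mat_vec_sum[OF F ax i] by simp
      finally show "(F *\<^sub>v (A ^\<^sub>m k *\<^sub>v x)) $ i
          = vec M (\<lambda>i. \<Sum>j<N. ?c j * (F *\<^sub>v (A ^\<^sub>m (j + l) *\<^sub>v x)) $ i) $ i" using i by simp
    qed (use F in auto)
    then show ?thesis
      using subspace_lincomb[OF V, of N "\<lambda>j. F *\<^sub>v (A ^\<^sub>m (j + l) *\<^sub>v x)" ?c] less k
      by (simp del: mult_minus_left)
  qed (rule small)
qed

section \<open>Reachable and unobservable subspaces\<close>

lemma ctrb_carrier:
  assumes "A \<in> carrier_mat N N"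
  shows "ctrb A B \<in> carrier_mat N (dim_col (ctrb A B))"
  using assms by (intro carrier_matI) (simp_all add: ctrb_def)

lemma subspace_reach:
  assumes "A \<in> carrier_mat N N"
  shows "is_subspace N (reach A B)"
  unfolding reach_def by (rule subspace_image_mat[OF ctrb_carrier[OF assms]])

lemma set_cols_ctrb:
  assumes "A \<in> carrier_mat N N" "B \<in> carrier_mat N M"
  shows "set (cols (ctrb A B)) = (\<Union>k<N. col (A ^\<^sub>m k * B) ` {..<M})"
proof -
  let ?L = "concat (map (\<lambda>k. cols (A ^\<^sub>m k * B)) [0..<N])"
  have "cols (A ^\<^sub>m k * B) = map (col (A ^\<^sub>m k * B)) [0..<M]" for k
    using assms by (simp add: cols_def)
  then have s: "set ?L = (\<Union>k<N. col (A ^\<^sub>m k * B) ` {..<M})"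
    by (auto simp: lessThan_atLeast0)
  have AB: "A ^\<^sub>m k * B \<in> carrier_mat N M" for k
    by (rule mult_carrier_mat[OF pow_carrier_mat[OF assms(1)] assms(2)])
  have "set ?L \<subseteq> carrier_vec N" unfolding s using col_carrier_vec[OF _ AB] by blast
  then have "cols (mat_of_cols N ?L) = ?L" by (rule cols_mat_of_cols)
  then show ?thesis unfolding ctrb_def using assms s by simp
qed

lemma col_eq_mult_unit_vec:
  fixes G :: "real mat"
  assumes "G \<in> carrier_mat N M" "j < M"
  shows "col G j = G *\<^sub>v unit_vec M j"
  using assms by (intro eq_vecI) auto

text \<open>Powers from \<open>N\<close> on are covered by Cayley--Hamilton. With
  \<open>reach_least\<close> this identifies \<open>reach A B\<close> as the smallest subspace
  containing all Krylov vectors, the only description used from here on.\<close>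

lemma krylov_in_reach:
  fixes A B :: "real mat"
  assumes A: "A \<in> carrier_mat N N" and B: "B \<in> carrier_mat N M" and u: "u \<in> carrier_vec M"
  shows "A ^\<^sub>m k *\<^sub>v (B *\<^sub>v u) \<in> reach A B"
proof -
  have cols: "col (ctrb A B) l \<in> reach A B" if "l < dim_col (ctrb A B)" for l
    unfolding reach_def col_eq_mult_unit_vec[OF ctrb_carrier[OF A] that] by simp
  have small: "A ^\<^sub>m k *\<^sub>v (B *\<^sub>v u) \<in> reach A B" if "k < N" for k
  proof -
    have AB: "A ^\<^sub>m k * B \<in> carrier_mat N M" by (rule mult_carrier_mat[OF pow_carrier_mat[OF A] B])
    have "col (A ^\<^sub>m k * B) j \<in> reach A B" if "j < M" for j
    proof -
      have "col (A ^\<^sub>m k * B) j \<in> set (cols (ctrb A B))"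
        using set_cols_ctrb[OF A B] \<open>k < N\<close> that by blast
      then show ?thesis using cols by (auto simp: cols_def)
    qed
    then show ?thesis
      using subspace_mult_mat_vec[OF subspace_reach[OF A] AB u] assoc_mult_mat_vec[of "A ^\<^sub>m k" N N B M u] A B u
      by simp
  qed
  have Bu: "B *\<^sub>v u \<in> carrier_vec N" using B u by simp
  have one: "1\<^sub>m N *\<^sub>v (A ^\<^sub>m j *\<^sub>v (B *\<^sub>v u)) = A ^\<^sub>m j *\<^sub>v (B *\<^sub>v u)" for j
    by (rule one_mult_mat_vec[OF pow_mat_mult_vec_carrier[OF A Bu]])
  show ?thesis
    using pow_mult_vec_subspace[OF A Bu subspace_reach[OF A] one_carrier_mat] small unfolding one by blast
qed

lemma reach_least:
  fixes A B :: "real mat"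
  assumes A: "A \<in> carrier_mat N N" and B: "B \<in> carrier_mat N M" and V: "is_subspace N V"
    and K: "\<And>k u. u \<in> carrier_vec M \<Longrightarrow> A ^\<^sub>m k *\<^sub>v (B *\<^sub>v u) \<in> V"
  shows "reach A B \<subseteq> V"
proof -
  have "col (ctrb A B) l \<in> V" if "l < dim_col (ctrb A B)" for l
  proof -
    have "col (ctrb A B) l \<in> set (cols (ctrb A B))" using that by (simp add: cols_def)
    then obtain k j where "j < M" "col (ctrb A B) l = col (A ^\<^sub>m k * B) j"
      unfolding set_cols_ctrb[OF A B] by blast
    moreover from this have "col (A ^\<^sub>m k * B) j = A ^\<^sub>m k *\<^sub>v (B *\<^sub>v unit_vec M j)"
      using A B by (subst col_eq_mult_unit_vec[of _ N M]) (auto intro!: assoc_mult_mat_vec)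
    ultimately show ?thesis using K[of "unit_vec M j" k] by simp
  qed
  then show ?thesis
    unfolding reach_def using subspace_mult_mat_vec[OF V ctrb_carrier[OF A]] by blast
qed

text \<open>The preimage of \<open>reach A B\<close> under \<open>A\<close> is a subspace, and it
  contains every Krylov vector because \<open>A\<close> sends the \<open>k\<close>-th to the next
  one. Minimality of \<open>reach A B\<close> does the rest.\<close>

lemma reach_invariant:
  fixes A B :: "real mat"
  assumes A: "A \<in> carrier_mat N N" and B: "B \<in> carrier_mat N M" and x: "x \<in> reach A B"
  shows "A *\<^sub>v x \<in> reach A B"
proof -
  have "reach A B \<subseteq> {x \<in> carrier_vec N. A *\<^sub>v x \<in> reach A B}"
  proof (rule reach_least[OF A B subspace_vimage_mat[OF A subspace_reach[OF A]]])
    fix k and u :: "real vec" assume u: "u \<in> carrier_vec M"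
    then have Bu: "B *\<^sub>v u \<in> carrier_vec N" using B by simp
    show "A ^\<^sub>m k *\<^sub>v (B *\<^sub>v u) \<in> {x \<in> carrier_vec N. A *\<^sub>v x \<in> reach A B}"
      using krylov_in_reach[OF A B u, of k] krylov_in_reach[OF A B u, of "Suc k"]
        subspace_carrier[OF subspace_reach[OF A]] pow_mat_Suc_mult_vec[OF A Bu, of k] by auto
  qed
  then show ?thesis using x by blast
qed

text \<open>Cayley--Hamilton lifts the bound on \<open>k\<close>; invariance under \<open>A\<close>
  then becomes a shift of \<open>k\<close>.\<close>

lemma unobs_iff:
  fixes A C :: "real mat"
  assumes A: "A \<in> carrier_mat N N" and C: "C \<in> carrier_mat R N"
  shows "x \<in> unobs C A \<longleftrightarrow> x \<in> carrier_vec N \<and> (\<forall>k. C *\<^sub>v (A ^\<^sub>m k *\<^sub>v x) = 0\<^sub>v R)"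
proof -
  have ker: "x \<in> mat_kernel (C * A ^\<^sub>m k) \<longleftrightarrow> C *\<^sub>v (A ^\<^sub>m k *\<^sub>v x) = 0\<^sub>v R"
    if "x \<in> carrier_vec N" for k
    using that assoc_mult_mat_vec[OF C pow_carrier_mat[OF A] that] A C
    by (simp add: mat_kernel_def)
  have "C *\<^sub>v (A ^\<^sub>m k *\<^sub>v x) = 0\<^sub>v R"
    if "x \<in> carrier_vec N" "\<And>k. k < N \<Longrightarrow> C *\<^sub>v (A ^\<^sub>m k *\<^sub>v x) = 0\<^sub>v R" for k
    using pow_mult_vec_subspace[OF A that(1) subspace_zero_space C] that(2) by blast
  then show ?thesis unfolding unobs_def using A ker by auto
qed

lemma subspace_unobs:
  fixes A C :: "real mat"
  assumes A: "A \<in> carrier_mat N N" and C: "C \<in> carrier_mat R N"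
  shows "is_subspace N (unobs C A)"
proof (rule subspaceI)
  have p: "A ^\<^sub>m k *\<^sub>v x \<in> carrier_vec N" if "x \<in> carrier_vec N" for x k
    by (rule pow_mat_mult_vec_carrier[OF A that])
  show "unobs C A \<subseteq> carrier_vec N" using unobs_iff[OF A C] by blast
  have "A ^\<^sub>m k *\<^sub>v 0\<^sub>v N = 0\<^sub>v N" for k using A pow_carrier_mat[OF A, of k] by auto
  then show "0\<^sub>v N \<in> unobs C A" using unobs_iff[OF A C] C by auto
  show "x + y \<in> unobs C A" if "x \<in> unobs C A" "y \<in> unobs C A" for x y
    using that C p unfolding unobs_iff[OF A C]
    by (auto simp: mult_add_distrib_mat_vec[OF pow_carrier_mat[OF A]] mult_add_distrib_mat_vec[OF C])
  show "c \<cdot>\<^sub>v x \<in> unobs C A" if "x \<in> unobs C A" for c x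
    using that C p unfolding unobs_iff[OF A C]
    by (auto simp: mult_mat_vec[OF pow_carrier_mat[OF A]] mult_mat_vec[OF C])
qed

lemma unobs_invariant:
  fixes A C :: "real mat"
  assumes A: "A \<in> carrier_mat N N" and C: "C \<in> carrier_mat R N" and x: "x \<in> unobs C A"
  shows "A *\<^sub>v x \<in> unobs C A"
proof -
  have "A ^\<^sub>m k *\<^sub>v (A *\<^sub>v x) = A ^\<^sub>m Suc k *\<^sub>v x" for k
    using x A assoc_mult_mat_vec[OF pow_carrier_mat[OF A] A] unfolding unobs_iff[OF A C] by auto
  then show ?thesis using x A unfolding unobs_iff[OF A C] by (auto simp del: pow_mat.simps)
qed

section \<open>Coordinate subspaces and submatrices\<close>

definition coord_space :: "nat \<Rightarrow> nat set \<Rightarrow> real vec set" where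
  "coord_space N I = {x \<in> carrier_vec N. \<forall>k<N. k \<notin> I \<longrightarrow> x $ k = 0}"

text \<open>The orthogonal projection onto \<open>coord_space N I\<close> in explicit form, as
  \<open>oproj_coord_space\<close> confirms; block computations thereby avoid
  \<open>THE\<close>.\<close>

definition cut :: "nat \<Rightarrow> nat set \<Rightarrow> real vec \<Rightarrow> real vec" where
  "cut N I x = vec N (\<lambda>k. if k \<in> I then x $ k else 0)"

lemma cut_carrier [simp]: "cut N I x \<in> carrier_vec N"
  by (simp add: cut_def)

lemma cut_in_coord_space [simp]: "cut N I x \<in> coord_space N I"
  by (auto simp: cut_def coord_space_def)

lemma coord_space_carrier: "x \<in> coord_space N I \<Longrightarrow> x \<in> carrier_vec N"
  by (simp add: coord_space_def)

lemma subspace_coord_space: "is_subspace N (coord_space N I)"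
  by (rule subspaceI) (auto simp: coord_space_def)

lemma cut_coord_space: "x \<in> coord_space N I \<Longrightarrow> cut N I x = x"
  by (intro eq_vecI) (auto simp: cut_def coord_space_def)

lemma cut_add: "x \<in> carrier_vec N \<Longrightarrow> y \<in> carrier_vec N \<Longrightarrow> cut N I (x + y) = cut N I x + cut N I y"
  by (intro eq_vecI) (auto simp: cut_def)

lemma cut_smult: "x \<in> carrier_vec N \<Longrightarrow> cut N I (c \<cdot>\<^sub>v x) = c \<cdot>\<^sub>v cut N I x"
  by (intro eq_vecI) (auto simp: cut_def)

lemma cut_zero: "cut N I (0\<^sub>v N) = 0\<^sub>v N"
  by (intro eq_vecI) (auto simp: cut_def)

lemma cut_disjoint: "x \<in> coord_space N I \<Longrightarrow> I \<inter> J = {} \<Longrightarrow> cut N J x = 0\<^sub>v N"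
  by (intro eq_vecI) (auto simp: cut_def coord_space_def)

lemma coord_space_mono: "I \<subseteq> J \<Longrightarrow> coord_space N I \<subseteq> coord_space N J"
  by (auto simp: coord_space_def)

lemma scalar_prod_cut:
  assumes "y \<in> coord_space N I" "x \<in> carrier_vec N"
  shows "x \<bullet> y = cut N I x \<bullet> y"
  using assms unfolding scalar_prod_def
  by (intro sum.cong) (auto simp: cut_def coord_space_def)

lemma scalar_prod_disjoint:
  assumes "x \<in> coord_space N I" "y \<in> coord_space N J" "I \<inter> J = {}"
  shows "x \<bullet> y = 0"
proof -
  have "x $ k * y $ k = 0" if "k < N" for k
    using assms that by (cases "k \<in> I") (auto simp: coord_space_def disjoint_iff)
  then show ?thesis
    using coord_space_carrier[OF assms(2)] by (auto simp: scalar_prod_def intro!: sum.neutral)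
qed

lemma oproj_coord_space:
  assumes "x \<in> carrier_vec N"
  shows "oproj (coord_space N I) x = cut N I x"
proof (rule oproj_eqI[OF subspace_coord_space assms])
  fix w assume w: "w \<in> coord_space N I"
  have "x - cut N I x \<in> coord_space N (- I)"
    using assms by (auto simp: coord_space_def cut_def)
  then show "(x - cut N I x) \<bullet> w = 0" using scalar_prod_disjoint w by blast
qed simp

lemma mult_coord_space:
  fixes G :: "real mat"
  assumes "G \<in> carrier_mat N M" "x \<in> coord_space M J"
    and "\<And>a b. a < N \<Longrightarrow> b < M \<Longrightarrow> a \<notin> I \<Longrightarrow> b \<in> J \<Longrightarrow> G $$ (a, b) = 0"
  shows "G *\<^sub>v x \<in> coord_space N I"
proof -
  have "(G *\<^sub>v x) $ a = 0" if "a < N" "a \<notin> I" for a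
    unfolding index_mult_mat_vec_sum[OF assms(1) coord_space_carrier[OF assms(2)] that(1)]
    using assms(2,3) that by (intro sum.neutral) (auto simp: coord_space_def)
  moreover have "G *\<^sub>v x \<in> carrier_vec N"
    using assms(1) coord_space_carrier[OF assms(2)] by simp
  ultimately show ?thesis by (simp add: coord_space_def)
qed

text \<open>The rows of \<open>G\<close> in \<open>I\<close> read only coordinates in
  \<open>J\<close>, so erasing the other coordinates of \<open>x\<close> does not affect
  them.\<close>

lemma cut_mult_cut:
  fixes G :: "real mat"
  assumes "G \<in> carrier_mat N M" "x \<in> carrier_vec M"
    and "\<And>a b. a < N \<Longrightarrow> b < M \<Longrightarrow> a \<in> I \<Longrightarrow> b \<notin> J \<Longrightarrow> G $$ (a, b) = 0"
  shows "cut N I (G *\<^sub>v cut M J x) = cut N I (G *\<^sub>v x)"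
proof (rule eq_vecI)
  fix a assume "a < dim_vec (cut N I (G *\<^sub>v x))"
  then have a: "a < N" by (simp add: cut_def)
  have "(G *\<^sub>v cut M J x) $ a = (G *\<^sub>v x) $ a" if "a \<in> I"
    unfolding index_mult_mat_vec_sum[OF assms(1) cut_carrier a] index_mult_mat_vec_sum[OF assms(1,2) a]
    using assms(3)[OF a _ that] by (intro sum.cong) (auto simp: cut_def)
  then show "cut N I (G *\<^sub>v cut M J x) $ a = cut N I (G *\<^sub>v x) $ a" using a by (simp add: cut_def)
qed (simp add: cut_def)

lemma pow_mult_coord_space:
  fixes A :: "real mat"
  assumes A: "A \<in> carrier_mat N N" and x: "x \<in> coord_space N I"
    and Z: "\<And>a b. a < N \<Longrightarrow> b < N \<Longrightarrow> a \<notin> I \<Longrightarrow> b \<in> I \<Longrightarrow> A $$ (a, b) = 0"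
  shows "A ^\<^sub>m k *\<^sub>v x \<in> coord_space N I"
proof (induction k)
  case 0
  then show ?case using A x coord_space_carrier[OF x] by simp
next
  case (Suc k)
  show ?case
    unfolding pow_mat_Suc_mult_vec[OF A coord_space_carrier[OF x]]
    by (rule mult_coord_space[OF A Suc Z])
qed

section \<open>Short vectors and submatrices\<close>

abbreviation short_dim :: "nat \<Rightarrow> nat set \<Rightarrow> nat" where
  "short_dim N I \<equiv> card {i. i < N \<and> i \<in> I}"

lemma rank_less:
  assumes "k < N" "k \<in> I"
  shows "card {a \<in> I. a < k} < short_dim N I"
  using assms by (intro psubset_card_mono) auto

text \<open>\<open>pick I\<close> inverts the rank, which gives injectivity; surjectivity follows by
  counting. It turns sums over short indices into sums over original positions.\<close>

lemma bij_betw_rank: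
  "bij_betw (\<lambda>k. card {a \<in> I. a < k}) {i. i < N \<and> i \<in> I} {..<short_dim N I}"
proof -
  have inj: "inj_on (\<lambda>k. card {a \<in> I. a < k}) {i. i < N \<and> i \<in> I}"
    by (rule inj_on_inverseI[where g = "pick I"]) (simp add: pick_card_in_set)
  moreover have "(\<lambda>k. card {a \<in> I. a < k}) ` {i. i < N \<and> i \<in> I} = {..<short_dim N I}"
    using rank_less[of _ N I] card_image[OF inj] by (intro card_subset_eq) auto
  ultimately show ?thesis by (simp add: bij_betw_def)
qed

lemma extend_in_coord_space: "extend N I v \<in> coord_space N I"
  by (auto simp: extend_def coord_space_def)

lemma extend_add:
  assumes "u \<in> carrier_vec (short_dim N I)" "v \<in> carrier_vec (short_dim N I)"
  shows "extend N I (u + v) = extend N I u + extend N I v"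
  using assms rank_less[of _ N I] by (intro eq_vecI) (auto simp: extend_def)

lemma extend_smult:
  assumes "u \<in> carrier_vec (short_dim N I)"
  shows "extend N I (c \<cdot>\<^sub>v u) = c \<cdot>\<^sub>v extend N I u"
  using assms rank_less[of _ N I] by (intro eq_vecI) (auto simp: extend_def)

lemma extend_zero: "extend N I (0\<^sub>v (short_dim N I)) = 0\<^sub>v N"
  using rank_less[of _ N I] by (intro eq_vecI) (auto simp: extend_def)

lemma extend_surj:
  assumes "x \<in> coord_space N I"
  obtains v where "v \<in> carrier_vec (short_dim N I)" "extend N I v = x"
proof
  show "vec (short_dim N I) (\<lambda>i. x $ pick I i) \<in> carrier_vec (short_dim N I)" by simp
  show "extend N I (vec (short_dim N I) (\<lambda>i. x $ pick I i)) = x"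
    using assms rank_less[of _ N I]
    by (intro eq_vecI) (auto simp: extend_def coord_space_def pick_card_in_set)
qed

lemma submatrix_carrier:
  "G \<in> carrier_mat N M \<Longrightarrow> submatrix G I J \<in> carrier_mat (short_dim N I) (short_dim M J)"
  by (intro carrier_matI) (auto simp: dim_submatrix)

text \<open>The extended vector vanishes off \<open>J\<close>, so the full row sums equal the short
  ones after reindexing by rank; \<open>cut\<close> discards the rows outside \<open>I\<close>. This
  is the bridge between truncated and full system.\<close>

lemma extend_submatrix_mult:
  fixes G :: "real mat"
  assumes G: "G \<in> carrier_mat N M" and v: "v \<in> carrier_vec (short_dim M J)"
  shows "extend N I (submatrix G I J *\<^sub>v v) = cut N I (G *\<^sub>v extend M J v)"
proof (rule eq_vecI)
  fix k assume "k < dim_vec (cut N I (G *\<^sub>v extend M J v))"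
  then have k: "k < N" by (simp add: cut_def)
  let ?r = "\<lambda>J k. card {a \<in> J. a < k}"
  have E: "extend M J v \<in> carrier_vec M" by (simp add: extend_def)
  have "(submatrix G I J *\<^sub>v v) $ ?r I k = (G *\<^sub>v extend M J v) $ k" if kI: "k \<in> I"
  proof -
    have "(submatrix G I J *\<^sub>v v) $ ?r I k = (\<Sum>b<short_dim M J. submatrix G I J $$ (?r I k, b) * v $ b)"
      by (rule index_mult_mat_vec_sum[OF submatrix_carrier[OF G] v rank_less[OF k kI]])
    also have "\<dots> = (\<Sum>b | b < M \<and> b \<in> J. submatrix G I J $$ (?r I k, ?r J b) * v $ ?r J b)"
      by (rule sum.reindex_bij_betw[OF bij_betw_rank, symmetric])
    also have "\<dots> = (\<Sum>b | b < M \<and> b \<in> J. G $$ (k, b) * extend M J v $ b)"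
      using G k kI by (intro sum.cong) (auto simp: submatrix_index_card extend_def)
    also have "\<dots> = (\<Sum>b<M. G $$ (k, b) * extend M J v $ b)"
      by (rule sum.mono_neutral_left) (auto simp: extend_def)
    also have "\<dots> = (G *\<^sub>v extend M J v) $ k"
      by (rule index_mult_mat_vec_sum[OF G E k, symmetric])
    finally show ?thesis .
  qed
  then show "extend N I (submatrix G I J *\<^sub>v v) $ k = cut N I (G *\<^sub>v extend M J v) $ k"
    using k by (simp add: extend_def cut_def)
qed (simp add: extend_def cut_def)

lemma subspace_extend_image:
  assumes "is_subspace (short_dim N I) V"
  shows "is_subspace N (extend N I ` V)"
proof (rule subspaceI)
  note car = subspace_carrier[OF assms]
  show "extend N I ` V \<subseteq> carrier_vec N" by (auto simp: extend_def)
  show "0\<^sub>v N \<in> extend N I ` V"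
    by (rule image_eqI[where f = "extend N I", OF extend_zero[symmetric] subspace_zero[OF assms]])
  show "x + y \<in> extend N I ` V" if xy: "x \<in> extend N I ` V" "y \<in> extend N I ` V" for x y
  proof -
    obtain u v where uv: "u \<in> V" "v \<in> V" "x = extend N I u" "y = extend N I v"
      using xy by blast
    have "x + y = extend N I (u + v)" unfolding uv(3,4) by (rule extend_add[OF car car, symmetric]) (fact uv)+
    then show ?thesis using subspace_add[OF assms uv(1,2)] by (rule image_eqI)
  qed
  show "c \<cdot>\<^sub>v x \<in> extend N I ` V" if x: "x \<in> extend N I ` V" for c x
  proof -
    obtain u where u: "u \<in> V" "x = extend N I u" using x by blast
    have "c \<cdot>\<^sub>v x = extend N I (c \<cdot>\<^sub>v u)" unfolding u(2) by (rule extend_smult[OF car, symmetric]) (fact u)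
    then show ?thesis using subspace_smult[OF assms u(1)] by (rule image_eqI)
  qed
qed

lemma subspace_extend_vimage:
  assumes "is_subspace N V"
  shows "is_subspace (short_dim N I) {v \<in> carrier_vec (short_dim N I). extend N I v \<in> V}"
  using subspace_zero[OF assms] subspace_add[OF assms] subspace_smult[OF assms]
  by (intro subspaceI) (auto simp: extend_zero extend_add extend_smult)

text \<open>Inputs from \<open>J\<close> enter only the coordinates \<open>I\<close>, and
  \<open>A\<close> keeps them there. Every \<open>cut\<close> produced by
  \<open>extend_submatrix_mult\<close> is therefore the identity, and Krylov vectors of the
  truncated system extend to those of the full one (\<open>kry\<close>). Thus \<open>R\<close> is
  generated by full Krylov vectors for inputs supported in \<open>J\<close>.\<close>

lemma
  fixes A B :: "real mat"
  assumes A: "A \<in> carrier_mat N N" and B: "B \<in> carrier_mat N M"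
    and ZA: "\<And>a b. a < N \<Longrightarrow> b < N \<Longrightarrow> a \<notin> I \<Longrightarrow> b \<in> I \<Longrightarrow> A $$ (a, b) = 0"
    and ZB: "\<And>a b. a < N \<Longrightarrow> b < M \<Longrightarrow> a \<notin> I \<Longrightarrow> b \<in> J \<Longrightarrow> B $$ (a, b) = 0"
  defines "R \<equiv> extend N I ` reach (submatrix A I I) (submatrix B I J)"
  shows subspace_extend_reach: "is_subspace N R"
    and krylov_in_extend_reach: "u \<in> coord_space M J \<Longrightarrow> A ^\<^sub>m k *\<^sub>v (B *\<^sub>v u) \<in> R"
    and extend_reach_least: "is_subspace N V \<Longrightarrow>
      (\<And>k u. u \<in> coord_space M J \<Longrightarrow> A ^\<^sub>m k *\<^sub>v (B *\<^sub>v u) \<in> V) \<Longrightarrow> R \<subseteq> V"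
proof -
  note A' = submatrix_carrier[OF A, of I I] and B' = submatrix_carrier[OF B, of I J]
  have kry: "extend N I (submatrix A I I ^\<^sub>m k *\<^sub>v (submatrix B I J *\<^sub>v v)) = A ^\<^sub>m k *\<^sub>v (B *\<^sub>v extend M J v)"
    if v: "v \<in> carrier_vec (short_dim M J)" for v k
  proof (induction k)
    case 0
    have B1: "B *\<^sub>v extend M J v \<in> coord_space N I"
      by (rule mult_coord_space[OF B extend_in_coord_space ZB])
    have "submatrix A I I ^\<^sub>m 0 *\<^sub>v (submatrix B I J *\<^sub>v v) = submatrix B I J *\<^sub>v v"
      using mult_mat_vec_carrier[OF B' v] carrier_matD[OF A'] by simp
    moreover have "A ^\<^sub>m 0 *\<^sub>v (B *\<^sub>v extend M J v) = B *\<^sub>v extend M J v"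
      using coord_space_carrier[OF B1] carrier_matD[OF A] by simp
    ultimately show ?case using extend_submatrix_mult[OF B v, of I] cut_coord_space[OF B1] by simp
  next
    case (Suc k)
    have Bv: "submatrix B I J *\<^sub>v v \<in> carrier_vec (short_dim N I)" by (rule mult_mat_vec_carrier[OF B' v])
    have Be: "B *\<^sub>v extend M J v \<in> carrier_vec N"
      by (rule mult_mat_vec_carrier[OF B coord_space_carrier[OF extend_in_coord_space]])
    have "A *\<^sub>v extend N I w \<in> coord_space N I" for w
      by (rule mult_coord_space[OF A extend_in_coord_space ZA])
    then show ?case
      unfolding pow_mat_Suc_mult_vec[OF A' Bv] pow_mat_Suc_mult_vec[OF A Be]
        extend_submatrix_mult[OF A pow_mat_mult_vec_carrier[OF A' Bv]] Suc[symmetric]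
      by (rule cut_coord_space)
  qed
  show "is_subspace N R" unfolding R_def by (rule subspace_extend_image[OF subspace_reach[OF A']])
  show "A ^\<^sub>m k *\<^sub>v (B *\<^sub>v u) \<in> R" if u: "u \<in> coord_space M J" for k u
  proof -
    obtain v where v: "v \<in> carrier_vec (short_dim M J)" "extend M J v = u" using extend_surj[OF u] .
    show ?thesis
      unfolding R_def v(2)[symmetric] kry[OF v(1), symmetric]
      by (rule imageI[OF krylov_in_reach[OF A' B' v(1)]])
  qed
  show "R \<subseteq> V" if V: "is_subspace N V"
    and K: "\<And>k u. u \<in> coord_space M J \<Longrightarrow> A ^\<^sub>m k *\<^sub>v (B *\<^sub>v u) \<in> V" for V
  proof -
    \<comment> \<open>Pulling \<open>V\<close> back along \<open>extend\<close> gives a subspace of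
      short vectors, to which minimality of the truncated reachable space applies.\<close>
    have "reach (submatrix A I I) (submatrix B I J) \<subseteq> {v \<in> carrier_vec (short_dim N I). extend N I v \<in> V}"
    proof (rule reach_least[OF A' B' subspace_extend_vimage[OF V]])
      fix k and u :: "real vec" assume u: "u \<in> carrier_vec (short_dim M J)"
      show "submatrix A I I ^\<^sub>m k *\<^sub>v (submatrix B I J *\<^sub>v u)
          \<in> {v \<in> carrier_vec (short_dim N I). extend N I v \<in> V}"
        using K[OF extend_in_coord_space] kry[OF u]
          pow_mat_mult_vec_carrier[OF A' mult_mat_vec_carrier[OF B' u]] by simp
    qed
    then show ?thesis unfolding R_def by blast
  qed
qed

text \<open>The dual situation: the trajectory of \<open>x\<close> may leave the coordinates
  \<open>I\<close>, but nothing outside \<open>I\<close> acts back on them. So the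
  \<open>I\<close>-part evolves as in the truncated system, and it is all that the outputs in
  \<open>J\<close> see.\<close>

lemma extend_unobs_submatrix:
  fixes A C :: "real mat"
  assumes A: "A \<in> carrier_mat N N" and C: "C \<in> carrier_mat M N"
    and ZA: "\<And>a b. a < N \<Longrightarrow> b < N \<Longrightarrow> a \<in> I \<Longrightarrow> b \<notin> I \<Longrightarrow> A $$ (a, b) = 0"
    and ZC: "\<And>a b. a < M \<Longrightarrow> b < N \<Longrightarrow> a \<in> J \<Longrightarrow> b \<notin> I \<Longrightarrow> C $$ (a, b) = 0"
    and x: "x \<in> extend N I ` unobs (submatrix C J I) (submatrix A I I)"
  shows "cut M J (C *\<^sub>v (A ^\<^sub>m k *\<^sub>v x)) = 0\<^sub>v M"
proof -
  note A' = submatrix_carrier[OF A, of I I] and C' = submatrix_carrier[OF C, of J I]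
  obtain v where v: "v \<in> unobs (submatrix C J I) (submatrix A I I)" "x = extend N I v" using x by blast
  have vc: "v \<in> carrier_vec (short_dim N I)"
    and vz: "\<And>k. submatrix C J I *\<^sub>v (submatrix A I I ^\<^sub>m k *\<^sub>v v) = 0\<^sub>v (short_dim M J)"
    using v(1) unfolding unobs_iff[OF A' C'] by auto
  have xI: "x \<in> coord_space N I" unfolding v(2) by (rule extend_in_coord_space)
  note xc = coord_space_carrier[OF xI]
  have *: "extend N I (submatrix A I I ^\<^sub>m k *\<^sub>v v) = cut N I (A ^\<^sub>m k *\<^sub>v x)" for k
  proof (induction k)
    case 0
    have "submatrix A I I ^\<^sub>m 0 *\<^sub>v v = v" using vc carrier_matD[OF A'] by simp
    moreover have "A ^\<^sub>m 0 *\<^sub>v x = x" using xc carrier_matD[OF A] by simp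
    ultimately show ?case using cut_coord_space[OF xI] v(2) by simp
  next
    case (Suc k)
    show ?case
      unfolding pow_mat_Suc_mult_vec[OF A' vc] pow_mat_Suc_mult_vec[OF A xc]
        extend_submatrix_mult[OF A pow_mat_mult_vec_carrier[OF A' vc]] Suc
      by (rule cut_mult_cut[OF A pow_mat_mult_vec_carrier[OF A xc] ZA])
  qed
  have "cut M J (C *\<^sub>v (A ^\<^sub>m k *\<^sub>v x)) = cut M J (C *\<^sub>v cut N I (A ^\<^sub>m k *\<^sub>v x))"
    by (rule cut_mult_cut[OF C pow_mat_mult_vec_carrier[OF A xc] ZC, symmetric])
  also have "\<dots> = extend M J (submatrix C J I *\<^sub>v (submatrix A I I ^\<^sub>m k *\<^sub>v v))"
    unfolding *[symmetric] by (rule extend_submatrix_mult[OF C pow_mat_mult_vec_carrier[OF A' vc], symmetric])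
  also have "\<dots> = 0\<^sub>v M" unfolding vz by (rule extend_zero)
  finally show ?thesis .
qed

section \<open>Sums of subspaces and block decompositions\<close>

lemma sum_spaces_least:
  assumes "finite S" "is_subspace N W" "\<And>i. i \<in> S \<Longrightarrow> V i \<subseteq> W"
  shows "sum_spaces N S V \<subseteq> W"
proof -
  have "finsum_vec TYPE(real) N v F \<in> W" if "F \<subseteq> S" "\<forall>i\<in>S. v i \<in> V i" for v F
    using finite_subset[OF that(1) assms(1)] that(1)
  proof (induction F)
    case empty
    then show ?case using subspace_zero[OF assms(2)] by (simp add: finsum_vec_empty)
  next
    case (insert i F)
    have vW: "v j \<in> W" if "j \<in> insert i F" for j
      using insert.prems that assms(3) \<open>\<forall>i\<in>S. v i \<in> V i\<close> by blast
    have "finsum_vec TYPE(real) N v (insert i F) = v i + finsum_vec TYPE(real) N v F"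
      using vW subspace_carrier[OF assms(2)] insert.hyps by (intro finsum_vec_insert) auto
    then show ?case using insert vW subspace_add[OF assms(2)] by simp
  qed
  then show ?thesis unfolding sum_spaces_def by blast
qed

lemma mem_sum_spaces:
  assumes "finite S" "\<And>i. i \<in> S \<Longrightarrow> is_subspace N (V i)" "i \<in> S" "x \<in> V i"
  shows "x \<in> sum_spaces N S V"
proof -
  define v where "v k = (if k = i then x else 0\<^sub>v N)" for k
  have xc: "x \<in> carrier_vec N" using assms(4) subspace_carrier[OF assms(2)[OF assms(3)]] by blast
  have vc: "v \<in> S \<rightarrow> carrier_vec N" using xc by (auto simp: v_def)
  have "finsum_vec TYPE(real) N v S = x"
  proof (rule eq_vecI)
    fix k assume "k < dim_vec x"
    then have k: "k < N" using xc by simp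
    have "(\<Sum>j\<in>S. v j $ k) = (\<Sum>j\<in>S. if j = i then x $ k else 0)"
      using k by (intro sum.cong) (auto simp: v_def)
    then show "finsum_vec TYPE(real) N v S $ k = x $ k"
      unfolding index_finsum_vec[OF assms(1) k vc] using assms(1,3) by simp
  next
    show "dim_vec (finsum_vec TYPE(real) N v S) = dim_vec x"
      using carrier_vecD[OF finsum_vec_closed[OF vc]] carrier_vecD[OF xc] by simp
  qed
  moreover have "\<forall>k\<in>S. v k \<in> V k"
    using assms(4) subspace_zero[OF assms(2)] by (auto simp: v_def)
  ultimately show ?thesis unfolding sum_spaces_def by blast
qed

lemma subspace_sum_spaces:
  assumes "finite S" "\<And>i. i \<in> S \<Longrightarrow> is_subspace N (V i)"
  shows "is_subspace N (sum_spaces N S V)"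
proof -
  have vc: "v \<in> S \<rightarrow> carrier_vec N" if "\<forall>i\<in>S. v i \<in> V i" for v
    using that subspace_carrier[OF assms(2)] by blast
  have cl: "finsum_vec TYPE(real) N v S \<in> carrier_vec N" if "\<forall>i\<in>S. v i \<in> V i" for v
    by (rule finsum_vec_closed[OF vc[OF that]])
  show ?thesis
  proof (rule subspaceI)
    show "sum_spaces N S V \<subseteq> carrier_vec N" unfolding sum_spaces_def using cl by blast
    have 0: "\<forall>i\<in>S. 0\<^sub>v N \<in> V i" using subspace_zero[OF assms(2)] by blast
    have "0\<^sub>v N = finsum_vec TYPE(real) N (\<lambda>_. 0\<^sub>v N) S"
      using carrier_vecD[OF cl[OF 0]] by (intro eq_vecI) (simp_all add: index_finsum_vec[OF assms(1)])
    then show "0\<^sub>v N \<in> sum_spaces N S V" unfolding sum_spaces_def using 0 by blast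
  next
    fix x y assume "x \<in> sum_spaces N S V" "y \<in> sum_spaces N S V"
    then obtain v w where v: "\<forall>i\<in>S. v i \<in> V i" "x = finsum_vec TYPE(real) N v S"
      and w: "\<forall>i\<in>S. w i \<in> V i" "y = finsum_vec TYPE(real) N w S"
      unfolding sum_spaces_def by blast
    have vw: "\<forall>i\<in>S. v i + w i \<in> V i" using v(1) w(1) subspace_add[OF assms(2)] by blast
    have c: "v i \<in> carrier_vec N" "w i \<in> carrier_vec N" if "i \<in> S" for i
      using vc[OF v(1)] vc[OF w(1)] that by auto
    have "x + y = finsum_vec TYPE(real) N (\<lambda>i. v i + w i) S"
    proof (rule eq_vecI)
      fix k assume "k < dim_vec (finsum_vec TYPE(real) N (\<lambda>i. v i + w i) S)"
      then have k: "k < N" using carrier_vecD[OF cl[OF vw]] by simp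
      have "(\<Sum>i\<in>S. (v i + w i) $ k) = (\<Sum>i\<in>S. v i $ k) + (\<Sum>i\<in>S. w i $ k)"
        unfolding sum.distrib[symmetric] using c(1) carrier_vecD[OF c(2)] k
        by (intro sum.cong refl index_add_vec) simp
      then show "(x + y) $ k = finsum_vec TYPE(real) N (\<lambda>i. v i + w i) S $ k"
        using k carrier_vecD[OF cl[OF v(1)]] carrier_vecD[OF cl[OF w(1)]] unfolding v(2) w(2)
        by (simp add: index_finsum_vec[OF assms(1) k vc[OF v(1)]]
            index_finsum_vec[OF assms(1) k vc[OF w(1)]] index_finsum_vec[OF assms(1) k vc[OF vw]])
    qed (use carrier_vecD[OF cl[OF vw]] carrier_vecD[OF cl[OF w(1)]] w(2) in simp)
    then show "x + y \<in> sum_spaces N S V" unfolding sum_spaces_def using vw by blast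
  next
    fix c x assume "x \<in> sum_spaces N S V"
    then obtain v where v: "\<forall>i\<in>S. v i \<in> V i" "x = finsum_vec TYPE(real) N v S"
      unfolding sum_spaces_def by blast
    have cv: "\<forall>i\<in>S. c \<cdot>\<^sub>v v i \<in> V i" using v(1) subspace_smult[OF assms(2)] by blast
    have "c \<cdot>\<^sub>v x = finsum_vec TYPE(real) N (\<lambda>i. c \<cdot>\<^sub>v v i) S"
    proof (rule eq_vecI)
      fix k assume "k < dim_vec (finsum_vec TYPE(real) N (\<lambda>i. c \<cdot>\<^sub>v v i) S)"
      then have k: "k < N" using carrier_vecD[OF cl[OF cv]] by simp
      have "(\<Sum>i\<in>S. (c \<cdot>\<^sub>v v i) $ k) = c * (\<Sum>i\<in>S. v i $ k)"
        unfolding sum_distrib_left using carrier_vecD[OF vc[OF v(1), THEN funcset_mem]] k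
        by (intro sum.cong refl index_smult_vec) simp
      then show "(c \<cdot>\<^sub>v x) $ k = finsum_vec TYPE(real) N (\<lambda>i. c \<cdot>\<^sub>v v i) S $ k"
        using k carrier_vecD[OF cl[OF v(1)]] unfolding v(2)
        by (simp add: index_finsum_vec[OF assms(1) k vc[OF v(1)]] index_finsum_vec[OF assms(1) k vc[OF cv]])
    qed (use carrier_vecD[OF cl[OF cv]] carrier_vecD[OF cl[OF v(1)]] v(2) in simp)
    then show "c \<cdot>\<^sub>v x \<in> sum_spaces N S V" unfolding sum_spaces_def using cv by blast
  qed
qed

section \<open>The partition into blocks\<close>

lemma blk_disjoint:
  assumes "i \<noteq> j"
  shows "blk n i \<inter> blk n j = {}"
proof -
  have *: "blk n i \<inter> blk n j = {}" if "i < j" for i j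
  proof -
    have "(\<Sum>k\<in>{1..i}. n k) \<le> (\<Sum>k\<in>{1..<j}. n k)" using that by (intro sum_mono2) auto
    then show ?thesis by (auto simp: blk_def)
  qed
  show ?thesis using *[of i j] *[of j i] assms by (cases "i < j") auto
qed

lemma blk_cover:
  assumes "k < total_dim p n"
  obtains j where "j \<in> {1..p}" "k \<in> blk n j"
proof -
  have "\<exists>j\<in>{1..p}. k \<in> blk n j"
    using assms
  proof (induction p)
    case 0
    then show ?case by (simp add: total_dim_def)
  next
    case (Suc p)
    show ?case
    proof (cases "k < total_dim p n")
      case True
      then show ?thesis using Suc.IH by force
    next
      case False
      then have "k \<in> blk n (Suc p)"
        using Suc.prems by (simp add: blk_def total_dim_def atLeastLessThanSuc_atLeastAtMost)
      then show ?thesis by (intro bexI[of _ "Suc p"]) auto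
    qed
  qed
  then show ?thesis using that by blast
qed

lemma blks_singleton: "blks n {i} = blk n i"
  by (simp add: blks_def)

lemma blk_blks_disjoint: "i \<notin> S \<Longrightarrow> blks n S \<inter> blk n i = {}"
  using blk_disjoint[of _ i n] unfolding blks_def by (fastforce simp: disjoint_iff)

lemma local_space_eq: "local_space p n j = coord_space (total_dim p n) (blk n j)"
  by (simp add: local_space_def coord_space_def)

lemma cut_blocks_eqI:
  assumes "x \<in> carrier_vec (total_dim p n)" "y \<in> carrier_vec (total_dim p n)"
    and "\<And>j. j \<in> {1..p} \<Longrightarrow> cut (total_dim p n) (blk n j) x = cut (total_dim p n) (blk n j) y"
  shows "x = y"
proof (rule eq_vecI)
  fix k assume "k < dim_vec y"
  then have k: "k < total_dim p n" using assms(2) by simp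
  then obtain j where j: "j \<in> {1..p}" "k \<in> blk n j" by (rule blk_cover)
  have "cut (total_dim p n) (blk n j) x $ k = cut (total_dim p n) (blk n j) y $ k"
    using assms(3)[OF j(1)] by simp
  then show "x $ k = y $ k" using k j(2) by (simp add: cut_def)
qed (use assms(1,2) in simp)

text \<open>Blocks do not overlap, so the summand in block \<open>j\<close> can only be the cut of
  \<open>x\<close> to that block. Membership becomes a test on each block separately, which is why
  intersections and orthogonal complements of block sums are again block sums.\<close>

lemma mem_block_sum_iff:
  assumes "\<And>j. j \<in> {1..p} \<Longrightarrow> is_subspace (total_dim p n) (V j)"
    and "\<And>j. j \<in> {1..p} \<Longrightarrow> V j \<subseteq> local_space p n j"
  shows "x \<in> sum_spaces (total_dim p n) {1..p} V \<longleftrightarrow>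
    x \<in> carrier_vec (total_dim p n) \<and> (\<forall>j\<in>{1..p}. cut (total_dim p n) (blk n j) x \<in> V j)"
    (is "?L \<longleftrightarrow> ?R")
proof
  let ?N = "total_dim p n"
  assume ?L
  then obtain v where v: "\<And>j. j \<in> {1..p} \<Longrightarrow> v j \<in> V j" "x = finsum_vec TYPE(real) ?N v {1..p}"
    unfolding sum_spaces_def by blast
  have vl: "v j \<in> coord_space ?N (blk n j)" if "j \<in> {1..p}" for j
    using v(1)[OF that] assms(2)[OF that] unfolding local_space_eq by blast
  have vc: "v \<in> {1..p} \<rightarrow> carrier_vec ?N" using vl coord_space_carrier by blast
  have xc: "x \<in> carrier_vec ?N" unfolding v(2) by (rule finsum_vec_closed[OF vc])
  have "cut ?N (blk n j) x = v j" if j: "j \<in> {1..p}" for j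
  proof (rule eq_vecI)
    fix k assume "k < dim_vec (v j)"
    then have k: "k < ?N" using coord_space_carrier[OF vl[OF j]] by simp
    show "cut ?N (blk n j) x $ k = v j $ k"
    proof (cases "k \<in> blk n j")
      case True
      have "v i $ k = 0" if "i \<in> {1..p} - {j}" for i
        using vl[of i] that k True blk_disjoint[of i j n] unfolding coord_space_def by blast
      then have "(\<Sum>i\<in>{1..p}. v i $ k) = v j $ k"
        using sum.remove[of "{1..p}" j "\<lambda>i. v i $ k"] j by simp
      moreover have "x $ k = (\<Sum>i\<in>{1..p}. v i $ k)"
        unfolding v(2) by (rule index_finsum_vec[OF _ k vc]) simp
      ultimately show ?thesis using k True by (simp add: cut_def)
    next
      case False
      then show ?thesis using k vl[OF j] by (simp add: cut_def coord_space_def)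
    qed
  qed (use coord_space_carrier[OF vl[OF j]] in \<open>simp add: cut_def\<close>)
  then show ?R using v(1) xc by simp
next
  let ?N = "total_dim p n"
  assume R: ?R
  let ?v = "\<lambda>j. cut ?N (blk n j) x"
  have vc: "?v \<in> {1..p} \<rightarrow> carrier_vec ?N" by simp
  have "x = finsum_vec TYPE(real) ?N ?v {1..p}"
  proof (rule eq_vecI)
    fix k assume "k < dim_vec (finsum_vec TYPE(real) ?N ?v {1..p})"
    then have k: "k < ?N" using carrier_vecD[OF finsum_vec_closed[OF vc]] by simp
    then obtain j where j: "j \<in> {1..p}" "k \<in> blk n j" by (rule blk_cover)
    have "?v i $ k = 0" if "i \<in> {1..p} - {j}" for i
      using that k j(2) blk_disjoint[of i j n] by (auto simp: cut_def)
    then have "(\<Sum>i\<in>{1..p}. ?v i $ k) = ?v j $ k"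
      using sum.remove[of "{1..p}" j "\<lambda>i. ?v i $ k"] j by simp
    also have "\<dots> = x $ k" using k j(2) by (simp add: cut_def)
    finally show "x $ k = finsum_vec TYPE(real) ?N ?v {1..p} $ k"
      by (subst index_finsum_vec[OF _ k vc]) simp_all
  qed (use R carrier_vecD[OF finsum_vec_closed[OF vc]] in simp)
  then show ?L unfolding sum_spaces_def using R by blast
qed

text \<open>By linearity, orthogonality to a sum is orthogonality to each \<open>W j\<close>, and a
  vector of \<open>W j\<close> sees only block \<open>j\<close> of \<open>x\<close>.\<close>

lemma ominus_block_sum:
  assumes V: "\<And>j. j \<in> {1..p} \<Longrightarrow> is_subspace (total_dim p n) (V j)"
      "\<And>j. j \<in> {1..p} \<Longrightarrow> V j \<subseteq> local_space p n j"
    and W: "\<And>j. j \<in> {1..p} \<Longrightarrow> is_subspace (total_dim p n) (W j)"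
      "\<And>j. j \<in> {1..p} \<Longrightarrow> W j \<subseteq> local_space p n j"
  shows "ominus (sum_spaces (total_dim p n) {1..p} V) (sum_spaces (total_dim p n) {1..p} W)
    = sum_spaces (total_dim p n) {1..p} (\<lambda>j. ominus (V j) (W j))"
proof (rule Set.set_eqI)
  fix x
  let ?N = "total_dim p n"
  have Wc: "W j \<subseteq> carrier_vec ?N" if "j \<in> {1..p}" for j
    using subspace_carrier[OF W(1)[OF that]] by blast
  have sub: "is_subspace ?N (ominus (V j) (W j))" if "j \<in> {1..p}" for j
    by (rule subspace_ominus[OF V(1)[OF that] Wc[OF that]])
  have loc: "ominus (V j) (W j) \<subseteq> local_space p n j" if "j \<in> {1..p}" for j
    using V(2)[OF that] unfolding ominus_def by blast
  have iffV: "x \<in> sum_spaces ?N {1..p} V \<longleftrightarrow>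
      x \<in> carrier_vec ?N \<and> (\<forall>j\<in>{1..p}. cut ?N (blk n j) x \<in> V j)"
    by (rule mem_block_sum_iff[OF V])
  have iffO: "x \<in> sum_spaces ?N {1..p} (\<lambda>j. ominus (V j) (W j)) \<longleftrightarrow>
      x \<in> carrier_vec ?N \<and> (\<forall>j\<in>{1..p}. cut ?N (blk n j) x \<in> ominus (V j) (W j))"
    by (rule mem_block_sum_iff[OF sub loc])
  have cut: "x \<bullet> w = cut ?N (blk n j) x \<bullet> w"
    if "x \<in> carrier_vec ?N" "j \<in> {1..p}" "w \<in> W j" for j w
    using W(2)[OF that(2)] that(3) scalar_prod_cut[OF _ that(1)] unfolding local_space_eq by blast
  have orth: "(\<forall>w\<in>sum_spaces ?N {1..p} W. x \<bullet> w = 0) \<longleftrightarrow> (\<forall>j\<in>{1..p}. \<forall>w\<in>W j. x \<bullet> w = 0)"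
    if x: "x \<in> carrier_vec ?N"
  proof
    assume "\<forall>w\<in>sum_spaces ?N {1..p} W. x \<bullet> w = 0"
    then show "\<forall>j\<in>{1..p}. \<forall>w\<in>W j. x \<bullet> w = 0"
      using mem_sum_spaces[where V = W and S = "{1..p}", OF _ W(1)] by blast
  next
    assume z: "\<forall>j\<in>{1..p}. \<forall>w\<in>W j. x \<bullet> w = 0"
    have "is_subspace ?N {w \<in> carrier_vec ?N. x \<bullet> w = 0}"
      using x by (intro subspaceI) (auto simp: scalar_prod_add_distrib[of x ?N])
    then have "sum_spaces ?N {1..p} W \<subseteq> {w \<in> carrier_vec ?N. x \<bullet> w = 0}"
      using z Wc by (intro sum_spaces_least) auto
    then show "\<forall>w\<in>sum_spaces ?N {1..p} W. x \<bullet> w = 0" by blast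
  qed
  have "x \<in> ominus (sum_spaces ?N {1..p} V) (sum_spaces ?N {1..p} W) \<longleftrightarrow>
    x \<in> carrier_vec ?N \<and> (\<forall>j\<in>{1..p}. cut ?N (blk n j) x \<in> V j) \<and> (\<forall>j\<in>{1..p}. \<forall>w\<in>W j. x \<bullet> w = 0)"
    unfolding ominus_def mem_Collect_eq iffV using orth by blast
  also have "\<dots> \<longleftrightarrow> x \<in> sum_spaces ?N {1..p} (\<lambda>j. ominus (V j) (W j))"
    unfolding iffO using cut by (auto simp: ominus_def)
  finally show "x \<in> ominus (sum_spaces ?N {1..p} V) (sum_spaces ?N {1..p} W) \<longleftrightarrow>
    x \<in> sum_spaces ?N {1..p} (\<lambda>j. ominus (V j) (W j))" .
qed

lemma subspace_cut_image:
  assumes "is_subspace N V"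
  shows "is_subspace N (cut N I ` V)"
proof (rule subspaceI)
  note car = subspace_carrier[OF assms]
  show "cut N I ` V \<subseteq> carrier_vec N" by auto
  show "0\<^sub>v N \<in> cut N I ` V"
    by (rule image_eqI[where f = "cut N I", OF cut_zero[symmetric] subspace_zero[OF assms]])
  show "x + y \<in> cut N I ` V" if xy: "x \<in> cut N I ` V" "y \<in> cut N I ` V" for x y
  proof -
    obtain u v where uv: "u \<in> V" "v \<in> V" "x = cut N I u" "y = cut N I v" using xy by blast
    have "x + y = cut N I (u + v)" unfolding uv(3,4) by (rule cut_add[OF car car, symmetric]) (fact uv)+
    then show ?thesis using subspace_add[OF assms uv(1,2)] by (rule image_eqI)
  qed
  show "c \<cdot>\<^sub>v x \<in> cut N I ` V" if x: "x \<in> cut N I ` V" for c x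
  proof -
    obtain u where u: "u \<in> V" "x = cut N I u" using x by blast
    have "c \<cdot>\<^sub>v x = cut N I (c \<cdot>\<^sub>v u)" unfolding u(2) by (rule cut_smult[OF car, symmetric]) (fact u)
    then show ?thesis using subspace_smult[OF assms u(1)] by (rule image_eqI)
  qed
qed

text \<open>The residual \<open>y - oproj X y\<close> is orthogonal to \<open>X\<close> and hence to
  \<open>V\<close>, so projecting to \<open>X\<close> first preserves orthogonality to
  \<open>V\<close>. This is what lets causality pass to compressions.\<close>

lemma oproj_oproj_eq_zero:
  assumes X: "is_subspace N X" and V: "is_subspace N V" "V \<subseteq> X" and y: "y \<in> carrier_vec N"
    and orth: "\<And>w. w \<in> V \<Longrightarrow> y \<bullet> w = 0"
  shows "oproj V (oproj X y) = 0\<^sub>v N"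
proof (rule oproj_eqI[OF V(1) _ subspace_zero[OF V(1)]])
  show P: "oproj X y \<in> carrier_vec N" by (rule subspace_carrier[OF X oproj_mem[OF X y]])
  fix w assume w: "w \<in> V"
  then have wc: "w \<in> carrier_vec N" by (rule subspace_carrier[OF V(1)])
  have "(y - oproj X y) \<bullet> w = 0" using oproj_orthogonal[OF X y] w V(2) by blast
  then have "oproj X y \<bullet> w = 0" using orth[OF w] minus_scalar_prod_distrib[OF y P wc] by simp
  moreover have "oproj X y - 0\<^sub>v N = oproj X y" using P by simp
  ultimately show "(oproj X y - 0\<^sub>v N) \<bullet> w = 0" by simp
qed

section \<open>Poset-causal systems\<close>

lemma incidence_carrier:
  "G \<in> incidence p ge n m \<Longrightarrow> G \<in> carrier_mat (total_dim p n) (total_dim p m)"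
  by (simp add: incidence_def)

lemma incidence_entry:
  assumes G: "G \<in> incidence p ge n m" and ij: "i \<in> {1..p}" "j \<in> {1..p}" "(j, i) \<notin> ge"
    and ab: "a \<in> blk n i" "a < total_dim p n" "b \<in> blk m j" "b < total_dim p m"
  shows "G $$ (a, b) = 0"
proof -
  have Z: "submatrix G (blk n i) (blk m j) = 0\<^sub>m (n i) (m j)"
    using G ij by (simp add: incidence_def block_submat_def blks_singleton)
  note c = incidence_carrier[OF G]
  have d: "dim_row G = total_dim p n" "dim_col G = total_dim p m" using c by auto
  \<comment> \<open>The dimensions of the block are read off from its equality with a zero matrix of
    known size, so the lengths of the index intervals need not be computed.\<close>
  have "short_dim (total_dim p n) (blk n i) = n i" "short_dim (total_dim p m) (blk m j) = m j"
    using arg_cong[OF Z, of dim_row] arg_cong[OF Z, of dim_col] unfolding dim_submatrix d by simp_all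
  then have r: "card {k \<in> blk n i. k < a} < n i" "card {k \<in> blk m j. k < b} < m j"
    using rank_less[OF ab(2,1)] rank_less[OF ab(4,3)] by simp_all
  have "G $$ (a, b) = submatrix G (blk n i) (blk m j) $$ (card {k \<in> blk n i. k < a}, card {k \<in> blk m j. k < b})"
    using ab d by (intro submatrix_index_card[symmetric]) auto
  then show ?thesis using r unfolding Z by simp
qed

locale poset_system =
  fixes p :: nat and ge :: "nat rel" and n m r :: "nat \<Rightarrow> nat" and A B C D :: "real mat"
  assumes partial_order: "partial_order_on {1..p} ge"
    and causal: "poset_causal_system p ge n m r A B C D"
begin

abbreviation "N \<equiv> total_dim p n"
abbreviation "M \<equiv> total_dim p m"
abbreviation "K \<equiv> total_dim p r"

lemma inc: "A \<in> incidence p ge n n" "B \<in> incidence p ge n m" "C \<in> incidence p ge r n" "D \<in> incidence p ge r m"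
  using causal by (auto simp: poset_causal_system_def)

lemmas A_carrier = incidence_carrier[OF inc(1)]
  and B_carrier = incidence_carrier[OF inc(2)]
  and C_carrier = incidence_carrier[OF inc(3)]

lemma ge_refl: "i \<in> {1..p} \<Longrightarrow> (i, i) \<in> ge"
  using partial_order by (auto simp: partial_order_on_def preorder_on_def refl_on_def)

lemma ge_trans: "(i, j) \<in> ge \<Longrightarrow> (j, k) \<in> ge \<Longrightarrow> (i, k) \<in> ge"
  using partial_order unfolding partial_order_on_def preorder_on_def trans_def by blast

section \<open>Down-sets and up-sets under causal matrices\<close>

abbreviation "dn \<equiv> down p ge"
abbreviation "upw \<equiv> up p ge"

lemma dn_subset: "dn i \<subseteq> {1..p}" and upw_subset: "upw i \<subseteq> {1..p}"
  by (auto simp: down_def up_def)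

text \<open>A block reached from one below \<open>i\<close> is itself below \<open>i\<close>, by
  transitivity.\<close>

lemma entry_down:
  assumes "G \<in> incidence p ge n' m'" "i \<in> {1..p}"
    and "a < total_dim p n'" "b < total_dim p m'" "a \<notin> blks n' (dn i)" "b \<in> blks m' (dn i)"
  shows "G $$ (a, b) = 0"
proof -
  obtain i' where i': "i' \<in> {1..p}" "a \<in> blk n' i'" by (rule blk_cover[OF assms(3)])
  obtain j where j: "j \<in> dn i" "b \<in> blk m' j" using assms(6) by (auto simp: blks_def)
  have "i' \<notin> dn i" using i' assms(5) by (auto simp: blks_def)
  then have "(j, i') \<notin> ge" using j(1) i'(1) ge_trans[of i j i'] by (auto simp: down_def)
  then show ?thesis
    using incidence_entry[OF assms(1) i'(1) _ _ i'(2) assms(3) j(2) assms(4)] j(1) dn_subset by blast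
qed

text \<open>Whatever acts on a block above \<open>i\<close> dominates that block, and so lies above
  \<open>i\<close> as well, by transitivity.\<close>

lemma entry_up:
  assumes "G \<in> incidence p ge n' m'" "i \<in> {1..p}"
    and "a < total_dim p n'" "b < total_dim p m'" "a \<in> blks n' (upw i)" "b \<notin> blks m' (upw i)"
  shows "G $$ (a, b) = 0"
proof -
  obtain j where j: "j \<in> {1..p}" "b \<in> blk m' j" by (rule blk_cover[OF assms(4)])
  obtain i' where i': "i' \<in> upw i" "a \<in> blk n' i'" using assms(5) by (auto simp: blks_def)
  have "j \<notin> upw i" using j assms(6) by (auto simp: blks_def)
  then have "(j, i') \<notin> ge" using i'(1) j(1) ge_trans[of j i' i] by (auto simp: up_def)
  then show ?thesis
    using incidence_entry[OF assms(1) _ j(1) _ i'(2) assms(3) j(2) assms(4)] i'(1) upw_subset by blast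
qed

lemma blk_subset_dn: "i \<in> {1..p} \<Longrightarrow> blk n' i \<subseteq> blks n' (dn i)"
  using ge_refl by (auto simp: blks_def down_def)

lemma blk_subset_up: "i \<in> {1..p} \<Longrightarrow> blk n' i \<subseteq> blks n' (upw i)"
  using ge_refl by (auto simp: blks_def up_def)

lemma incidence_mult_local:
  assumes "G \<in> incidence p ge n' m'" "i \<in> {1..p}" "x \<in> local_space p m' i"
  shows "G *\<^sub>v x \<in> coord_space (total_dim p n') (blks n' (dn i))"
proof (rule mult_coord_space[OF incidence_carrier[OF assms(1)]])
  show "x \<in> coord_space (total_dim p m') (blks m' (dn i))"
    using assms(3) coord_space_mono[OF blk_subset_dn[OF assms(2)]] unfolding local_space_eq by blast
qed (rule entry_down[OF assms(1,2)])

section \<open>Local reachable and unobservable spaces\<close>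

abbreviation "Rl \<equiv> R_loc p ge n m A B"
abbreviation "Nl \<equiv> N_loc p ge n r A C"

lemma R_loc_eq: "Rl i = extend N (blks n (dn i)) `
    reach (submatrix A (blks n (dn i)) (blks n (dn i))) (submatrix B (blks n (dn i)) (blk m i))"
  by (simp add: R_loc_def block_submat_def blks_singleton)

lemma N_loc_eq: "Nl i = extend N (blks n (upw i)) `
    unobs (submatrix C (blk r i) (blks n (upw i))) (submatrix A (blks n (upw i)) (blks n (upw i)))"
  by (simp add: N_loc_def block_submat_def blks_singleton)

text \<open>The truncation results with the blocks of \<open>dn i\<close> as state coordinates and
  block \<open>i\<close> as input. The generators of \<open>Rl i\<close> are Krylov vectors of the
  full system, hence reachable.\<close>

lemma
  assumes i: "i \<in> {1..p}"
  shows subspace_R_loc: "is_subspace N (Rl i)"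
    and krylov_in_R_loc: "u \<in> coord_space M (blk m i) \<Longrightarrow> A ^\<^sub>m k *\<^sub>v (B *\<^sub>v u) \<in> Rl i"
    and R_loc_subset_reach: "Rl i \<subseteq> reach A B"
proof -
  have ZB: "B $$ (a, b) = 0" if "a < N" "b < M" "a \<notin> blks n (dn i)" "b \<in> blk m i" for a b
    using entry_down[OF inc(2) i that(1-3)] blk_subset_dn[OF i] that(4) by blast
  note ZA = entry_down[OF inc(1) i]
  show "is_subspace N (Rl i)"
    unfolding R_loc_eq by (rule subspace_extend_reach[OF A_carrier B_carrier ZA ZB])
  show "A ^\<^sub>m k *\<^sub>v (B *\<^sub>v u) \<in> Rl i" if "u \<in> coord_space M (blk m i)" for k u
    unfolding R_loc_eq by (rule krylov_in_extend_reach[OF A_carrier B_carrier ZA ZB that])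
  show "Rl i \<subseteq> reach A B"
    unfolding R_loc_eq
    by (rule extend_reach_least[OF A_carrier B_carrier ZA ZB subspace_reach[OF A_carrier]
          krylov_in_reach[OF A_carrier B_carrier coord_space_carrier]])
qed

lemma R_loc_subset_coord_space: "Rl i \<subseteq> coord_space N (blks n (dn i))"
  unfolding R_loc_eq using extend_in_coord_space by blast

lemma oproj_local_space: "x \<in> carrier_vec (total_dim p n') \<Longrightarrow> oproj (local_space p n' j) x = cut (total_dim p n') (blk n' j) x"
  unfolding local_space_eq by (rule oproj_coord_space)

lemma oproj_R_loc:
  assumes "i \<in> {1..p}"
  shows "oproj (local_space p n j) ` Rl i = cut N (blk n j) ` Rl i"
  using oproj_local_space subspace_carrier[OF subspace_R_loc[OF assms]] by (auto simp: image_iff)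

definition "Rt j = sum_spaces N (upw j) (\<lambda>i. oproj (local_space p n j) ` Rl i)"
definition "Rb j = sum_spaces N (upw j) (\<lambda>i. local_space p n j \<inter> Rl i)"
definition "Nb j = (\<Inter>i\<in>dn j. Nl i \<inter> local_space p n j)"

lemma finite_upw: "finite (upw j)"
  by (rule finite_subset[OF upw_subset]) simp

lemma subspace_local_space: "is_subspace (total_dim p n') (local_space p n' j)"
  unfolding local_space_eq by (rule subspace_coord_space)

lemma subspace_oproj_R_loc: "i \<in> {1..p} \<Longrightarrow> is_subspace N (oproj (local_space p n j) ` Rl i)"
  unfolding oproj_R_loc by (rule subspace_cut_image[OF subspace_R_loc])

lemma subspace_Rt: "is_subspace N (Rt j)"
  unfolding Rt_def using upw_subset by (intro subspace_sum_spaces[OF finite_upw] subspace_oproj_R_loc) blast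

lemma subspace_Rb: "is_subspace N (Rb j)"
  unfolding Rb_def using upw_subset
  by (intro subspace_sum_spaces[OF finite_upw] subspace_Int[OF subspace_local_space subspace_R_loc]) blast

lemma Rt_subset_local_space: "Rt j \<subseteq> local_space p n j"
  unfolding Rt_def
proof (rule sum_spaces_least[OF finite_upw subspace_local_space])
  fix i assume "i \<in> upw j"
  then have i: "i \<in> {1..p}" using upw_subset by blast
  show "oproj (local_space p n j) ` Rl i \<subseteq> local_space p n j"
    unfolding oproj_R_loc[OF i] unfolding local_space_eq by auto
qed

lemma cut_R_loc_in_Rt:
  assumes i: "i \<in> upw j" and x: "x \<in> Rl i"
  shows "cut N (blk n j) x \<in> Rt j"
proof -
  have up: "k \<in> {1..p}" if "k \<in> upw j" for k using that upw_subset by blast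
  have "cut N (blk n j) x \<in> oproj (local_space p n j) ` Rl i"
    unfolding oproj_R_loc[OF up[OF i]] using x by (rule imageI)
  then show ?thesis
    unfolding Rt_def using up subspace_oproj_R_loc
    by (intro mem_sum_spaces[where i = i and V = "\<lambda>i. oproj (local_space p n j) ` Rl i",
          OF finite_upw _ i]) simp_all
qed

lemma Rb_subset_Rt: "Rb j \<subseteq> Rt j"
  unfolding Rb_def
proof (rule sum_spaces_least[OF finite_upw subspace_Rt], rule subsetI)
  fix i x assume i: "i \<in> upw j" and x: "x \<in> local_space p n j \<inter> Rl i"
  have "cut N (blk n j) x = x" using x by (intro cut_coord_space) (simp add: local_space_eq)
  then show "x \<in> Rt j" using cut_R_loc_in_Rt[OF i, of x] x by simp
qed

text \<open>Intersecting with the local space, instead of projecting to it, is what keeps these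
  vectors in \<open>Rl i\<close> and so in \<open>reach A B\<close>.\<close>

lemma Rb_subset_reach: "Rb j \<subseteq> reach A B"
  unfolding Rb_def
  using R_loc_subset_reach upw_subset by (intro sum_spaces_least[OF finite_upw subspace_reach[OF A_carrier]]) blast

lemma reach_subset_R_tilde: "reach A B \<subseteq> sum_spaces N {1..p} Rt"
proof (rule reach_least[OF A_carrier B_carrier])
  show sub: "is_subspace N (sum_spaces N {1..p} Rt)"
    by (rule subspace_sum_spaces[OF _ subspace_Rt]) simp
  fix k and u :: "real vec" assume u: "u \<in> carrier_vec M"
  have AB: "A ^\<^sub>m k * B \<in> carrier_mat N M"
    by (rule mult_carrier_mat[OF pow_carrier_mat[OF A_carrier] B_carrier])
  have eq: "(A ^\<^sub>m k * B) *\<^sub>v w = A ^\<^sub>m k *\<^sub>v (B *\<^sub>v w)" if "w \<in> carrier_vec M" for w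
    by (rule assoc_mult_mat_vec[OF pow_carrier_mat[OF A_carrier] B_carrier that])
  have "u \<in> sum_spaces M {1..p} (local_space p m)"
    using u by (subst mem_block_sum_iff[OF subspace_local_space]) (auto simp: local_space_eq)
  \<comment> \<open>Splitting the input into blocks is expressed through a preimage subspace: it
    suffices that it contains each block of inputs.\<close>
  also have "\<dots> \<subseteq> {w \<in> carrier_vec M. (A ^\<^sub>m k * B) *\<^sub>v w \<in> sum_spaces N {1..p} Rt}"
  proof (rule sum_spaces_least[OF _ subspace_vimage_mat[OF AB sub]], simp, rule subsetI)
    fix i w assume i: "i \<in> {1..p}" and w: "w \<in> local_space p m i"
    have wc: "w \<in> coord_space M (blk m i)" using w by (simp add: local_space_eq)
    define x where "x = A ^\<^sub>m k *\<^sub>v (B *\<^sub>v w)"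
    have x: "x \<in> Rl i" unfolding x_def by (rule krylov_in_R_loc[OF i wc])
    have xc: "x \<in> carrier_vec N" by (rule subspace_carrier[OF subspace_R_loc[OF i] x])
    have "cut N (blk n j) x \<in> Rt j" if j: "j \<in> {1..p}" for j
    \<comment> \<open>Block \<open>j\<close> of \<open>x\<close> lies in a summand of
      \<open>Rt j\<close> by definition when \<open>i\<close> dominates \<open>j\<close>; otherwise
      it is zero, as \<open>x\<close> is supported on the down-set of \<open>i\<close>.\<close>
    proof (cases "(i, j) \<in> ge")
      case True
      then have "i \<in> upw j" using i by (simp add: up_def)
      then show ?thesis using x by (rule cut_R_loc_in_Rt)
    next
      case False
      then have "cut N (blk n j) x = 0\<^sub>v N"
        using x R_loc_subset_coord_space[of i] by (intro cut_disjoint[OF _ blk_blks_disjoint[of j "dn i"]]) (auto simp: down_def)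
      then show ?thesis using subspace_zero[OF subspace_Rt] by simp
    qed
    then have "x \<in> sum_spaces N {1..p} Rt"
      using xc by (subst mem_block_sum_iff[OF subspace_Rt Rt_subset_local_space]) auto
    then show "w \<in> {w \<in> carrier_vec M. (A ^\<^sub>m k * B) *\<^sub>v w \<in> sum_spaces N {1..p} Rt}"
      using eq coord_space_carrier[OF wc] unfolding x_def by simp
  qed
  finally show "A ^\<^sub>m k *\<^sub>v (B *\<^sub>v u) \<in> sum_spaces N {1..p} Rt" using eq[OF u] by simp
qed

lemma subspace_N_loc: "is_subspace N (Nl i)"
  unfolding N_loc_eq
  by (rule subspace_extend_image[OF
        subspace_unobs[OF submatrix_carrier[OF A_carrier] submatrix_carrier[OF C_carrier]]])

lemma subspace_Nb:
  assumes "j \<in> {1..p}"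
  shows "is_subspace N (Nb j)"
proof -
  \<comment> \<open>By reflexivity; an intersection over the empty index set would be the universe,
    which is no subspace.\<close>
  have ne: "dn j \<noteq> {}" using assms ge_refl by (auto simp: down_def)
  have sub: "is_subspace N (Nl i \<inter> local_space p n j)" for i
    by (rule subspace_Int[OF subspace_N_loc subspace_local_space])
  show ?thesis
    unfolding Nb_def by (rule subspace_INT[OF ne sub])
qed

lemma Nb_subset_local_space: "j \<in> {1..p} \<Longrightarrow> Nb j \<subseteq> local_space p n j"
  using ge_refl[of j] unfolding Nb_def down_def by blast

text \<open>Outputs \<open>i\<close> below \<open>j\<close> vanish because \<open>x\<close> lies in \<open>\<N>\<^sub>i\<close>, the others by causality.\<close>

lemma Nb_subset_unobs:
  assumes j: "j \<in> {1..p}"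
  shows "Nb j \<subseteq> unobs C A"
proof
  fix x assume x: "x \<in> Nb j"
  have xj: "x \<in> coord_space N (blk n j)"
    using Nb_subset_local_space[OF j] x unfolding local_space_eq by blast
  note xc = coord_space_carrier[OF xj]
  have "C *\<^sub>v (A ^\<^sub>m k *\<^sub>v x) = 0\<^sub>v K" for k
  proof (rule cut_blocks_eqI)
    show "C *\<^sub>v (A ^\<^sub>m k *\<^sub>v x) \<in> carrier_vec K"
      by (rule mult_mat_vec_carrier[OF C_carrier pow_mat_mult_vec_carrier[OF A_carrier xc]])
    fix i assume i: "i \<in> {1..p}"
    show "cut K (blk r i) (C *\<^sub>v (A ^\<^sub>m k *\<^sub>v x)) = cut K (blk r i) (0\<^sub>v K)"
    proof (cases "(j, i) \<in> ge")
      case True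
      then have "x \<in> Nl i" using x i unfolding Nb_def down_def by blast
      moreover have "C $$ (a, b) = 0" if "a < K" "b < N" "a \<in> blk r i" "b \<notin> blks n (upw i)" for a b
        using entry_up[OF inc(3) i that(1,2) _ that(4)] blk_subset_up[OF i] that(3) by blast
      ultimately show ?thesis
        unfolding N_loc_eq cut_zero
        by (intro extend_unobs_submatrix[OF A_carrier C_carrier entry_up[OF inc(1) i]]) auto
    next
      case False
      \<comment> \<open>What starts in block \<open>j\<close> stays in the blocks of
        \<open>dn j\<close>, and output block \<open>i\<close> is not among them here.\<close>
      have "A ^\<^sub>m k *\<^sub>v x \<in> coord_space N (blks n (dn j))"
        using xj coord_space_mono[OF blk_subset_dn[OF j]]
        by (intro pow_mult_coord_space[OF A_carrier _ entry_down[OF inc(1) j]]) auto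
      then have "C *\<^sub>v (A ^\<^sub>m k *\<^sub>v x) \<in> coord_space K (blks r (dn j))"
        by (rule mult_coord_space[OF C_carrier _ entry_down[OF inc(3) j]])
      then show ?thesis
        unfolding cut_zero using False
        by (intro cut_disjoint[OF _ blk_blks_disjoint]) (auto simp: down_def)
    qed
  qed simp
  then show "x \<in> unobs C A" unfolding unobs_iff[OF A_carrier C_carrier] using xc by blast
qed

section \<open>The removed subspace and the reduced state space\<close>

definition "Wl j = Rb j \<inter> Nb j"
definition "Vl j = ominus (Rt j) (Wl j)"

lemma subspace_Wl: "j \<in> {1..p} \<Longrightarrow> is_subspace N (Wl j)"
  unfolding Wl_def by (rule subspace_Int[OF subspace_Rb subspace_Nb])

lemma Wl_subset_local_space: "j \<in> {1..p} \<Longrightarrow> Wl j \<subseteq> local_space p n j"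
  unfolding Wl_def using Nb_subset_local_space by blast

lemma subspace_Vl:
  assumes "j \<in> {1..p}"
  shows "is_subspace N (Vl j)"
  unfolding Vl_def using subspace_carrier[OF subspace_Wl[OF assms]]
  by (intro subspace_ominus[OF subspace_Rt]) blast

lemma Vl_subset_local_space: "Vl j \<subseteq> local_space p n j"
  using Rt_subset_local_space unfolding Vl_def ominus_def by blast

abbreviation "X \<equiv> X_tilde p ge n m r A B C"
abbreviation "W \<equiv> sum_spaces N {1..p} Wl"

text \<open>Both memberships are tested block by block on the same cuts of \<open>x\<close>, so the
  intersection may be taken within each block.\<close>

lemma R_bar_Int_N_bar: "R_bar p ge n m A B \<inter> N_bar p ge n r A C = W"
proof (rule Set.set_eqI)
  fix x
  have Rb: "R_bar p ge n m A B = sum_spaces N {1..p} Rb" and Nb: "N_bar p ge n r A C = sum_spaces N {1..p} Nb"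
    unfolding R_bar_def N_bar_def Rb_def[abs_def] Nb_def[abs_def] by simp_all
  have "x \<in> sum_spaces N {1..p} Rb \<longleftrightarrow> x \<in> carrier_vec N \<and> (\<forall>j\<in>{1..p}. cut N (blk n j) x \<in> Rb j)"
    using Rb_subset_Rt Rt_subset_local_space by (intro mem_block_sum_iff[OF subspace_Rb]) blast
  moreover have "x \<in> sum_spaces N {1..p} Nb \<longleftrightarrow> x \<in> carrier_vec N \<and> (\<forall>j\<in>{1..p}. cut N (blk n j) x \<in> Nb j)"
    by (rule mem_block_sum_iff[OF subspace_Nb Nb_subset_local_space])
  moreover have "x \<in> W \<longleftrightarrow> x \<in> carrier_vec N \<and> (\<forall>j\<in>{1..p}. cut N (blk n j) x \<in> Wl j)"
    by (rule mem_block_sum_iff[OF subspace_Wl Wl_subset_local_space])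
  ultimately show "x \<in> R_bar p ge n m A B \<inter> N_bar p ge n r A C \<longleftrightarrow> x \<in> W"
    unfolding Rb Nb Wl_def by blast
qed

lemma R_tilde_eq: "R_tilde p ge n m A B = sum_spaces N {1..p} Rt"
  unfolding R_tilde_def Rt_def[abs_def] by simp

lemma X_eq_ominus: "X = ominus (sum_spaces N {1..p} Rt) W"
  unfolding X_tilde_def R_bar_Int_N_bar R_tilde_eq by simp

lemma X_eq: "X = sum_spaces N {1..p} Vl"
  unfolding X_eq_ominus Vl_def[abs_def]
  by (rule ominus_block_sum[OF subspace_Rt Rt_subset_local_space subspace_Wl Wl_subset_local_space])

lemma subspace_X: "is_subspace N X"
  unfolding X_eq by (rule subspace_sum_spaces[OF _ subspace_Vl]) simp

lemma subspace_W: "is_subspace N W"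
  by (rule subspace_sum_spaces[OF _ subspace_Wl]) simp

lemma W_subset_reach: "W \<subseteq> reach A B" and W_subset_unobs: "W \<subseteq> unobs C A"
  using Rb_subset_reach Nb_subset_unobs unfolding Wl_def
  by (intro sum_spaces_least subspace_reach[OF A_carrier] subspace_unobs[OF A_carrier C_carrier]; auto)+

text \<open>Since \<open>W \<subseteq> \<R> \<subseteq> \<R>~\<close>, projecting a reachable state to \<open>X\<close> only removes a component in \<open>W\<close>.\<close>

lemma oproj_X_reach:
  assumes x: "x \<in> reach A B"
  obtains w where "w \<in> W" "oproj X x = x - w"
proof
  have xc: "x \<in> carrier_vec N" by (rule subspace_carrier[OF subspace_reach[OF A_carrier] x])
  show w: "oproj W x \<in> W" by (rule oproj_mem[OF subspace_W xc])
  have wc: "oproj W x \<in> carrier_vec N" by (rule subspace_carrier[OF subspace_W w])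
  show "oproj X x = x - oproj W x"
  proof (rule oproj_eqI[OF subspace_X xc])
    \<comment> \<open>Being reachable, the difference lies in \<open>R_tilde\<close>, and it is
      orthogonal to \<open>W\<close>: this is membership in \<open>X\<close>. What is left over,
      \<open>oproj W x\<close>, is orthogonal to \<open>X\<close> by construction of
      \<open>X\<close>.\<close>
    have "x - oproj W x \<in> reach A B"
      using subspace_diff[OF subspace_reach[OF A_carrier] x] w W_subset_reach by blast
    then show "x - oproj W x \<in> X"
      unfolding X_eq_ominus ominus_def using reach_subset_R_tilde oproj_orthogonal[OF subspace_W xc] by blast
    fix t assume t: "t \<in> X"
    have tc: "t \<in> carrier_vec N" by (rule subspace_carrier[OF subspace_X t])
    have "t \<bullet> oproj W x = 0" using t w unfolding X_eq_ominus ominus_def by blast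
    moreover have "x - (x - oproj W x) = oproj W x" using xc wc by (intro eq_vecI) auto
    ultimately show "(x - (x - oproj W x)) \<bullet> t = 0" using comm_scalar_prod[OF tc wc] by simp
  qed
qed

text \<open>The three claims support one another in the induction: membership in \<open>X\<close>
  allows the restricted function \<open>compr_A\<close> to be evaluated, reachability makes the next
  projection remove only a vector of \<open>W\<close>, and the error against the full trajectory
  stays invisible to the output.\<close>

lemma trajectory:
  assumes u: "u \<in> carrier_vec M"
  defines "y \<equiv> \<lambda>k. (compr_A X A ^^ k) (compr_B X B u)"
  shows "y k \<in> X \<and> y k \<in> reach A B \<and> A ^\<^sub>m k *\<^sub>v (B *\<^sub>v u) - y k \<in> unobs C A"
proof -
  note subR = subspace_reach[OF A_carrier, of B] and subN = subspace_unobs[OF A_carrier C_carrier]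
  have Bc: "B *\<^sub>v u \<in> carrier_vec N" by (rule mult_mat_vec_carrier[OF B_carrier u])
  \<comment> \<open>Projecting subtracts some \<open>w\<close> in \<open>W\<close>, which is both
    reachable and unobservable: the state stays reachable and the error changes by an unobservable
    vector.\<close>
  have step: "oproj X x \<in> X \<and> oproj X x \<in> reach A B \<and> z - oproj X x \<in> unobs C A"
    if x: "x \<in> reach A B" and z: "z \<in> carrier_vec N" "z - x \<in> unobs C A" for x z
  proof -
    have xc: "x \<in> carrier_vec N" by (rule subspace_carrier[OF subR x])
    obtain w where w: "w \<in> W" "oproj X x = x - w" by (rule oproj_X_reach[OF x])
    have wc: "w \<in> carrier_vec N" by (rule subspace_carrier[OF subspace_W w(1)])
    have "z - (x - w) = (z - x) + w" using xc wc z(1) by (intro eq_vecI) auto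
    then have "z - (x - w) \<in> unobs C A" using subspace_add[OF subN z(2)] w(1) W_subset_unobs by auto
    moreover have "x - w \<in> reach A B" using subspace_diff[OF subR x] w(1) W_subset_reach by blast
    ultimately show ?thesis using oproj_mem[OF subspace_X xc] w(2) by simp
  qed
  show ?thesis
  proof (induction k)
    case 0
    have "A ^\<^sub>m 0 *\<^sub>v (B *\<^sub>v u) = B *\<^sub>v u" using Bc carrier_matD[OF A_carrier] by simp
    moreover have "y 0 = oproj X (B *\<^sub>v u)"
      unfolding y_def compr_B_def using u carrier_matD[OF B_carrier] by simp
    moreover have "B *\<^sub>v u - B *\<^sub>v u = 0\<^sub>v N" using Bc by simp
    ultimately show ?case
      using step[of "B *\<^sub>v u" "B *\<^sub>v u"] krylov_in_reach[OF A_carrier B_carrier u, of 0] Bc subspace_zero[OF subN]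
      by simp
  next
    case (Suc k)
    let ?z = "A ^\<^sub>m k *\<^sub>v (B *\<^sub>v u)"
    have zc: "?z \<in> carrier_vec N" by (rule pow_mat_mult_vec_carrier[OF A_carrier Bc])
    have yc: "y k \<in> carrier_vec N" using Suc subspace_carrier[OF subR] by blast
    have "y (Suc k) = oproj X (A *\<^sub>v y k)"
      using Suc unfolding y_def compr_A_def by simp
    moreover have "A ^\<^sub>m Suc k *\<^sub>v (B *\<^sub>v u) = A *\<^sub>v ?z" by (rule pow_mat_Suc_mult_vec[OF A_carrier Bc])
    moreover have "A *\<^sub>v y k \<in> reach A B" using Suc reach_invariant[OF A_carrier B_carrier] by blast
    moreover have "A *\<^sub>v ?z - A *\<^sub>v y k \<in> unobs C A"
      using Suc unobs_invariant[OF A_carrier C_carrier] mult_minus_distrib_mat_vec[OF A_carrier zc yc] by metis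
    ultimately show ?case
      using step[of "A *\<^sub>v y k" "A *\<^sub>v ?z"] mult_mat_vec_carrier[OF A_carrier zc] by simp
  qed
qed

lemma markov_parameters:
  assumes u: "u \<in> carrier_vec M"
  shows "(C * A ^\<^sub>m k * B) *\<^sub>v u = compr_C X C ((compr_A X A ^^ k) (compr_B X B u))"
proof -
  define y where "y = (compr_A X A ^^ k) (compr_B X B u)"
  let ?z = "A ^\<^sub>m k *\<^sub>v (B *\<^sub>v u)"
  have y: "y \<in> X" "?z - y \<in> unobs C A" using trajectory[OF u, of k] unfolding y_def by blast+
  have Bc: "B *\<^sub>v u \<in> carrier_vec N" by (rule mult_mat_vec_carrier[OF B_carrier u])
  have zc: "?z \<in> carrier_vec N" by (rule pow_mat_mult_vec_carrier[OF A_carrier Bc])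
  have yc: "y \<in> carrier_vec N" by (rule subspace_carrier[OF subspace_X y(1)])
  \<comment> \<open>The zeroth power in the description of \<open>unobs\<close> says that
    \<open>C\<close> annihilates the error.\<close>
  have "C *\<^sub>v (A ^\<^sub>m 0 *\<^sub>v (?z - y)) = 0\<^sub>v K" using y(2) unfolding unobs_iff[OF A_carrier C_carrier] by blast
  moreover have "A ^\<^sub>m 0 *\<^sub>v (?z - y) = ?z - y" using zc yc carrier_matD[OF A_carrier] by simp
  ultimately have d: "C *\<^sub>v ?z - C *\<^sub>v y = 0\<^sub>v K" using mult_minus_distrib_mat_vec[OF C_carrier zc yc] by simp
  have "C *\<^sub>v ?z = C *\<^sub>v y"
  proof (rule eq_vecI)
    fix i assume "i < dim_vec (C *\<^sub>v y)"
    then have i: "i < K" using carrier_matD(1)[OF C_carrier] by simp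
    have "(C *\<^sub>v ?z - C *\<^sub>v y) $ i = 0" using i unfolding d by simp
    then show "(C *\<^sub>v ?z) $ i = (C *\<^sub>v y) $ i" using carrier_matD(1)[OF C_carrier] i by simp
  qed simp
  moreover have "(C * A ^\<^sub>m k * B) *\<^sub>v u = C *\<^sub>v ?z"
    using assoc_mult_mat_vec[OF mult_carrier_mat[OF C_carrier pow_carrier_mat[OF A_carrier]] B_carrier u]
      assoc_mult_mat_vec[OF C_carrier pow_carrier_mat[OF A_carrier] Bc] by simp
  moreover have "compr_C X C y = C *\<^sub>v y" using y(1) by (simp add: compr_C_def)
  ultimately show ?thesis unfolding y_def by simp
qed

section \<open>Causality of the compressions and minimality\<close>

lemma Vl_subset_X: "j \<in> {1..p} \<Longrightarrow> Vl j \<subseteq> X"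
  unfolding X_eq using mem_sum_spaces[where V = Vl and S = "{1..p}", OF _ subspace_Vl] by blast

text \<open>The vector \<open>G *\<^sub>v x\<close> is supported on the down-set of
  \<open>j\<close>, which misses block \<open>i\<close>, so it is orthogonal to \<open>Vl i\<close>;
  the projection to \<open>X\<close> preserves this. One statement serves both \<open>A\<close> and
  \<open>B\<close>.\<close>

lemma compression_causal:
  assumes G: "G \<in> incidence p ge n m'" and ij: "i \<in> {1..p}" "j \<in> {1..p}" "(j, i) \<notin> ge"
    and x: "x \<in> local_space p m' j"
  shows "oproj (Vl i) (oproj X (G *\<^sub>v x)) = 0\<^sub>v N"
proof (rule oproj_oproj_eq_zero[OF subspace_X subspace_Vl[OF ij(1)] Vl_subset_X[OF ij(1)]])
  have Gx: "G *\<^sub>v x \<in> coord_space N (blks n (dn j))" by (rule incidence_mult_local[OF G ij(2) x])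
  then show "G *\<^sub>v x \<in> carrier_vec N" by (rule coord_space_carrier)
  fix w assume "w \<in> Vl i"
  then have "w \<in> coord_space N (blk n i)" using Vl_subset_local_space unfolding local_space_eq by blast
  moreover have "i \<notin> dn j" using ij(3) by (simp add: down_def)
  ultimately show "(G *\<^sub>v x) \<bullet> w = 0" using scalar_prod_disjoint[OF Gx _ blk_blks_disjoint] by blast
qed

lemma reduction: "poset_causal_reduction p ge n m r A B C D X"
  unfolding poset_causal_reduction_def
proof (intro conjI exI[of _ Vl] ballI allI)
  show "X = sum_spaces N {1..p} Vl" by (rule X_eq)
  show "D \<in> incidence p ge r m" by (rule inc(4))
  show "incidence_map p ge N Vl Vl (compr_A X A)"
    unfolding incidence_map_def
  proof (intro ballI impI)
    fix i j x assume ij: "i \<in> {1..p}" "j \<in> {1..p}" "(j, i) \<notin> ge" and x: "x \<in> Vl j"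
    have "compr_A X A x = oproj X (A *\<^sub>v x)" using x Vl_subset_X[OF ij(2)] by (auto simp: compr_A_def)
    then show "oproj (Vl i) (compr_A X A x) = 0\<^sub>v N"
      using compression_causal[OF inc(1) ij] x Vl_subset_local_space by auto
  qed
  show "incidence_map p ge N Vl (local_space p m) (compr_B X B)"
    unfolding incidence_map_def
  proof (intro ballI impI)
    fix i j x assume ij: "i \<in> {1..p}" "j \<in> {1..p}" "(j, i) \<notin> ge" and x: "x \<in> local_space p m j"
    have "x \<in> carrier_vec (dim_col B)"
      using subspace_carrier[OF subspace_local_space x] carrier_matD[OF B_carrier] by simp
    then have "compr_B X B x = oproj X (B *\<^sub>v x)" by (simp add: compr_B_def)
    then show "oproj (Vl i) (compr_B X B x) = 0\<^sub>v N"
      using compression_causal[OF inc(2) ij x] by simp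
  qed
  show "incidence_map p ge K (local_space p r) Vl (compr_C X C)"
    unfolding incidence_map_def
  proof (intro ballI impI)
    fix i j x assume ij: "i \<in> {1..p}" "j \<in> {1..p}" "(j, i) \<notin> ge" and x: "x \<in> Vl j"
    have C: "C *\<^sub>v x \<in> coord_space K (blks r (dn j))"
      using incidence_mult_local[OF inc(3) ij(2)] x Vl_subset_local_space by blast
    have "compr_C X C x = C *\<^sub>v x" using x Vl_subset_X[OF ij(2)] by (auto simp: compr_C_def)
    then have "oproj (local_space p r i) (compr_C X C x) = cut K (blk r i) (C *\<^sub>v x)"
      using oproj_local_space[OF coord_space_carrier[OF C]] by simp
    also have "\<dots> = 0\<^sub>v K"
      using ij(3) by (intro cut_disjoint[OF C blk_blks_disjoint]) (simp add: down_def)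
    finally show "oproj (local_space p r i) (compr_C X C x) = 0\<^sub>v K" .
  qed
qed (use subspace_Vl Vl_subset_local_space markov_parameters in blast)+

lemma minimality:
  assumes proj: "\<forall>j\<in>{1..p}. oproj (local_space p n j) ` X = oproj (local_space p n j) ` X_co A B C"
    and V: "\<forall>j\<in>{1..p}. is_subspace N (V j) \<and> V j \<subseteq> local_space p n j"
    and co: "X_co A B C \<subseteq> sum_spaces N {1..p} V"
  shows "X \<subseteq> sum_spaces N {1..p} V"
proof
  have iff: "x \<in> sum_spaces N {1..p} V \<longleftrightarrow> x \<in> carrier_vec N \<and> (\<forall>j\<in>{1..p}. cut N (blk n j) x \<in> V j)" for x
    using V by (intro mem_block_sum_iff) blast+
  fix x assume x: "x \<in> X"
  have xc: "x \<in> carrier_vec N" by (rule subspace_carrier[OF subspace_X x])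
  have "cut N (blk n j) x \<in> V j" if j: "j \<in> {1..p}" for j
  proof -
    \<comment> \<open>The vector \<open>z\<close> depends on \<open>j\<close>, and no single one
      need match \<open>x\<close> in all blocks. Since the larger space is a block sum, one witness
      per block is enough.\<close>
    obtain z where z: "z \<in> X_co A B C" "oproj (local_space p n j) x = oproj (local_space p n j) z"
      using proj j x by blast
    have zV: "z \<in> sum_spaces N {1..p} V" using z(1) co by blast
    then have "z \<in> carrier_vec N" "cut N (blk n j) z \<in> V j" using j unfolding iff by blast+
    then show ?thesis using z(2) xc oproj_local_space by simp
  qed
  then show "x \<in> sum_spaces N {1..p} V" unfolding iff using xc by blast
qed

end

theorem proposition6p4:
  fixes p :: nat and ge :: "nat rel" and n m r :: "nat \<Rightarrow> nat"
    and A B C D :: "real mat"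
  assumes "partial_order_on {1..p} ge"
    and "poset_causal_system p ge n m r A B C D"
  shows "poset_causal_reduction p ge n m r A B C D (X_tilde p ge n m r A B C) \<and>
    ((\<forall>j\<in>{1..p}. oproj (local_space p n j) ` X_tilde p ge n m r A B C =
                  oproj (local_space p n j) ` X_co A B C) \<longrightarrow>
     (\<forall>V. (\<forall>j\<in>{1..p}. is_subspace (total_dim p n) (V j) \<and> V j \<subseteq> local_space p n j) \<longrightarrow>
          X_co A B C \<subseteq> sum_spaces (total_dim p n) {1..p} V \<longrightarrow>
          X_tilde p ge n m r A B C \<subseteq> sum_spaces (total_dim p n) {1..p} V))"
proof -
  interpret poset_system p ge n m r A B C D by (rule poset_system.intro[OF assms])
  show ?thesis using reduction minimality by blast
qed

end
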